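(* Work in ZFC. In transitive-set potentialism $\mathcal{T}$, the following are equivalent for a transitive set $M$: (1) $\mathrm{Val}_{\mathcal{T}}(M,\mathcal{L}_{\in,M})=\mathrm{S5}$; (2) $M=V_\delta$ for some $\Sigma_2$-correct cardinal $\delta$ (i.e. $V_\delta\prec_{\Sigma_2}V$).
   Context: $\mathcal{T}$ is the potentialist system whose worlds are all transitive sets, with $W$ accessing $U$ iff $W\subseteq U$; $\Diamond\varphi$ at $W$ means $\varphi$ holds at some transitive $U\supseteq W$, $\Box\varphi$ at all such; quantifiers range over the current world. $\mathcal{L}_{\in,M}$ is the language of set theory with parameters from $M$; $\mathrm{Val}_{\mathcal{T}}(M,\mathcal{L}')$ is the set of propositional modal formulas all of whose substitution instances by $\mathcal{L}'$-assertions are true at $M$. *)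

theory Defs
  imports Main
begin

text \<open>
  ``Work in ZFC'' is rendered semantically: the universe of sets is an arbitrary type \<open>'a\<close> with an
  arbitrary relation \<open>E\<close> (read \<open>E x y\<close> as ``x is an element of y'') satisfying the first-order axioms
  of ZFC, with Separation and Replacement as schemes over first-order formulas. The model
  may be ill-founded, so every set-theoretic notion below (ordinal, function, \<open>V\<^sub>\<delta>\<close>,
  cardinal, \<open>\<dots>\<close>) is the internal one, i.e. all its quantifiers range over the elements of the model.
\<close>

datatype 'a trm = Var nat | Par 'a

datatype 'a fm =
    FMem "'a trm" "'a trm"
  | FEq "'a trm" "'a trm"
  | FNeg "'a fm"
  | FAnd "'a fm" "'a fm"
  | FEx nat "'a fm"
  | FAll nat "'a fm"

definition FImp :: "'a fm \<Rightarrow> 'a fm \<Rightarrow> 'a fm" where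
  "FImp \<phi> \<psi> = FNeg (FAnd \<phi> (FNeg \<psi>))"

fun fv_trm :: "'a trm \<Rightarrow> nat set" where
  "fv_trm (Var n) = {n}"
| "fv_trm (Par a) = {}"

fun fv :: "'a fm \<Rightarrow> nat set" where
  "fv (FMem s t) = fv_trm s \<union> fv_trm t"
| "fv (FEq s t) = fv_trm s \<union> fv_trm t"
| "fv (FNeg \<phi>) = fv \<phi>"
| "fv (FAnd \<phi> \<psi>) = fv \<phi> \<union> fv \<psi>"
| "fv (FEx n \<phi>) = fv \<phi> - {n}"
| "fv (FAll n \<phi>) = fv \<phi> - {n}"

abbreviation params :: "'a fm \<Rightarrow> 'a set" where
  "params \<equiv> set_fm"

fun val :: "(nat \<Rightarrow> 'a) \<Rightarrow> 'a trm \<Rightarrow> 'a" where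
  "val e (Var n) = e n"
| "val e (Par a) = a"

fun sat :: "('a \<Rightarrow> 'a \<Rightarrow> bool) \<Rightarrow> 'a set \<Rightarrow> (nat \<Rightarrow> 'a) \<Rightarrow> 'a fm \<Rightarrow> bool" where
  "sat E D e (FMem s t) = E (val e s) (val e t)"
| "sat E D e (FEq s t) = (val e s = val e t)"
| "sat E D e (FNeg \<phi>) = (\<not> sat E D e \<phi>)"
| "sat E D e (FAnd \<phi> \<psi>) = (sat E D e \<phi> \<and> sat E D e \<psi>)"
| "sat E D e (FEx n \<phi>) = (\<exists>x\<in>D. sat E D (e(n := x)) \<phi>)"
| "sat E D e (FAll n \<phi>) = (\<forall>x\<in>D. sat E D (e(n := x)) \<phi>)"

text \<open>
  Only used for sentences, whose truth value does not depend on the assignment. Assignments are not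
  required to take values in \<open>D\<close>, so that sentences are evaluated correctly in the empty structure.
\<close>

definition models :: "('a \<Rightarrow> 'a \<Rightarrow> bool) \<Rightarrow> 'a set \<Rightarrow> 'a fm \<Rightarrow> bool" where
  "models E D \<phi> \<longleftrightarrow> (\<forall>e. sat E D e \<phi>)"

definition ext :: "('a \<Rightarrow> 'a \<Rightarrow> bool) \<Rightarrow> 'a \<Rightarrow> 'a set" where
  "ext E A = {x. E x A}"

definition lang :: "('a \<Rightarrow> 'a \<Rightarrow> bool) \<Rightarrow> 'a \<Rightarrow> 'a fm set" where
  "lang E A = {\<phi>. fv \<phi> = {} \<and> params \<phi> \<subseteq> ext E A}"

inductive Delta0_fm :: "'a fm \<Rightarrow> bool" where
  "Delta0_fm (FMem s t)"
| "Delta0_fm (FEq s t)"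
| "Delta0_fm \<phi> \<Longrightarrow> Delta0_fm (FNeg \<phi>)"
| "Delta0_fm \<phi> \<Longrightarrow> Delta0_fm \<psi> \<Longrightarrow> Delta0_fm (FAnd \<phi> \<psi>)"
| "Delta0_fm \<phi> \<Longrightarrow> t \<noteq> Var n \<Longrightarrow> Delta0_fm (FEx n (FAnd (FMem (Var n) t) \<phi>))"
| "Delta0_fm \<phi> \<Longrightarrow> t \<noteq> Var n \<Longrightarrow> Delta0_fm (FAll n (FImp (FMem (Var n) t) \<phi>))"

inductive Sigma_fm :: "nat \<Rightarrow> 'a fm \<Rightarrow> bool" and Pi_fm :: "nat \<Rightarrow> 'a fm \<Rightarrow> bool" where
  "Delta0_fm \<phi> \<Longrightarrow> Sigma_fm 0 \<phi>"
| "Delta0_fm \<phi> \<Longrightarrow> Pi_fm 0 \<phi>"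
| "Pi_fm n \<phi> \<Longrightarrow> Sigma_fm (Suc n) \<phi>"
| "Sigma_fm (Suc n) \<phi> \<Longrightarrow> Sigma_fm (Suc n) (FEx k \<phi>)"
| "Sigma_fm n \<phi> \<Longrightarrow> Pi_fm (Suc n) \<phi>"
| "Pi_fm (Suc n) \<phi> \<Longrightarrow> Pi_fm (Suc n) (FAll k \<phi>)"

definition subset :: "('a \<Rightarrow> 'a \<Rightarrow> bool) \<Rightarrow> 'a \<Rightarrow> 'a \<Rightarrow> bool" where
  "subset E x y \<longleftrightarrow> (\<forall>z. E z x \<longrightarrow> E z y)"

locale ZFC =
  fixes E :: "'a \<Rightarrow> 'a \<Rightarrow> bool"
  assumes extensionality: "\<forall>x y. (\<forall>z. E z x \<longleftrightarrow> E z y) \<longrightarrow> x = y"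
    and foundation: "\<forall>x. (\<exists>y. E y x) \<longrightarrow> (\<exists>y. E y x \<and> (\<forall>z. E z x \<longrightarrow> \<not> E z y))"
    and pairing: "\<forall>x y. \<exists>z. \<forall>w. E w z \<longleftrightarrow> w = x \<or> w = y"
    and union: "\<forall>x. \<exists>u. \<forall>z. E z u \<longleftrightarrow> (\<exists>y. E y x \<and> E z y)"
    and power_set: "\<forall>x. \<exists>p. \<forall>z. E z p \<longleftrightarrow> subset E z x"
    and infinity: "\<exists>w. (\<exists>z. E z w \<and> (\<forall>x. \<not> E x z)) \<and>
      (\<forall>x. E x w \<longrightarrow> (\<exists>s. E s w \<and> (\<forall>z. E z s \<longleftrightarrow> E z x \<or> z = x)))"
    and choice: "\<forall>F. (\<forall>x. E x F \<longrightarrow> (\<exists>z. E z x)) \<and>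
      (\<forall>x y. E x F \<and> E y F \<and> x \<noteq> y \<longrightarrow> \<not> (\<exists>z. E z x \<and> E z y)) \<longrightarrow>
      (\<exists>c. \<forall>x. E x F \<longrightarrow> (\<exists>!z. E z x \<and> E z c))"
    and separation: "\<forall>\<phi> e a. \<exists>b. \<forall>x. E x b \<longleftrightarrow> E x a \<and> sat E UNIV (e(0 := x)) \<phi>"
    and replacement: "\<forall>\<phi> e a.
      (\<forall>x y z. E x a \<and> sat E UNIV (e(0 := x, 1 := y)) \<phi> \<and> sat E UNIV (e(0 := x, 1 := z)) \<phi>
        \<longrightarrow> y = z) \<longrightarrow>
      (\<exists>b. \<forall>y. E y b \<longleftrightarrow> (\<exists>x. E x a \<and> sat E UNIV (e(0 := x, 1 := y)) \<phi>))"

definition trans_set :: "('a \<Rightarrow> 'a \<Rightarrow> bool) \<Rightarrow> 'a \<Rightarrow> bool" where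
  "trans_set E x \<longleftrightarrow> (\<forall>y. E y x \<longrightarrow> subset E y x)"

definition is_ordinal :: "('a \<Rightarrow> 'a \<Rightarrow> bool) \<Rightarrow> 'a \<Rightarrow> bool" where
  "is_ordinal E \<alpha> \<longleftrightarrow> trans_set E \<alpha> \<and> (\<forall>\<beta>. E \<beta> \<alpha> \<longrightarrow> trans_set E \<beta>)"

definition is_upair :: "('a \<Rightarrow> 'a \<Rightarrow> bool) \<Rightarrow> 'a \<Rightarrow> 'a \<Rightarrow> 'a \<Rightarrow> bool" where
  "is_upair E x y z \<longleftrightarrow> (\<forall>w. E w z \<longleftrightarrow> w = x \<or> w = y)"

definition is_opair :: "('a \<Rightarrow> 'a \<Rightarrow> bool) \<Rightarrow> 'a \<Rightarrow> 'a \<Rightarrow> 'a \<Rightarrow> bool" where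
  "is_opair E x y p \<longleftrightarrow> (\<exists>a b. is_upair E x x a \<and> is_upair E x y b \<and> is_upair E a b p)"

definition maps_to :: "('a \<Rightarrow> 'a \<Rightarrow> bool) \<Rightarrow> 'a \<Rightarrow> 'a \<Rightarrow> 'a \<Rightarrow> bool" where
  "maps_to E f x y \<longleftrightarrow> (\<exists>p. E p f \<and> is_opair E x y p)"

definition is_function :: "('a \<Rightarrow> 'a \<Rightarrow> bool) \<Rightarrow> 'a \<Rightarrow> 'a \<Rightarrow> bool" where
  "is_function E f d \<longleftrightarrow>
     (\<forall>p. E p f \<longrightarrow> (\<exists>x y. E x d \<and> is_opair E x y p)) \<and>
     (\<forall>x. E x d \<longrightarrow> (\<exists>!y. maps_to E f x y))"

definition is_bijection :: "('a \<Rightarrow> 'a \<Rightarrow> bool) \<Rightarrow> 'a \<Rightarrow> 'a \<Rightarrow> 'a \<Rightarrow> bool" where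
  "is_bijection E f a b \<longleftrightarrow> is_function E f a \<and>
     (\<forall>x y. maps_to E f x y \<longrightarrow> E y b) \<and>
     (\<forall>y. E y b \<longrightarrow> (\<exists>!x. maps_to E f x y))"

definition is_cardinal :: "('a \<Rightarrow> 'a \<Rightarrow> bool) \<Rightarrow> 'a \<Rightarrow> bool" where
  "is_cardinal E \<kappa> \<longleftrightarrow> is_ordinal E \<kappa> \<and> (\<forall>\<beta>. E \<beta> \<kappa> \<longrightarrow> \<not> (\<exists>f. is_bijection E f \<beta> \<kappa>))"

definition is_succ :: "('a \<Rightarrow> 'a \<Rightarrow> bool) \<Rightarrow> 'a \<Rightarrow> 'a \<Rightarrow> bool" where
  "is_succ E \<alpha> s \<longleftrightarrow> (\<forall>x. E x s \<longleftrightarrow> E x \<alpha> \<or> x = \<alpha>)"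

text \<open>
  \<open>v = V\<^sub>\<alpha>\<close>, where \<open>V\<^sub>\<beta>\<close> is the union of the power sets of the \<open>V\<^sub>\<gamma>\<close>, \<open>\<gamma> < \<beta>\<close>; the recursion is witnessed by
  a function \<open>f\<close> on \<open>\<alpha> + 1\<close> that is an element of the model.
\<close>

definition is_V :: "('a \<Rightarrow> 'a \<Rightarrow> bool) \<Rightarrow> 'a \<Rightarrow> 'a \<Rightarrow> bool" where
  "is_V E \<alpha> v \<longleftrightarrow> is_ordinal E \<alpha> \<and>
     (\<exists>f s. is_succ E \<alpha> s \<and> is_function E f s \<and>
        (\<forall>\<beta> u. maps_to E f \<beta> u \<longrightarrow>
           (\<forall>x. E x u \<longleftrightarrow> (\<exists>\<gamma> w. E \<gamma> \<beta> \<and> maps_to E f \<gamma> w \<and> subset E x w))) \<and>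
        maps_to E f \<alpha> v)"

definition Sigma_elementary :: "('a \<Rightarrow> 'a \<Rightarrow> bool) \<Rightarrow> nat \<Rightarrow> 'a \<Rightarrow> bool" where
  "Sigma_elementary E n A \<longleftrightarrow>
     (\<forall>\<phi>\<in>lang E A. Sigma_fm n \<phi> \<longrightarrow> (models E (ext E A) \<phi> \<longleftrightarrow> models E UNIV \<phi>))"

definition Sigma_correct_cardinal :: "('a \<Rightarrow> 'a \<Rightarrow> bool) \<Rightarrow> nat \<Rightarrow> 'a \<Rightarrow> bool" where
  "Sigma_correct_cardinal E n \<delta> \<longleftrightarrow>
     is_cardinal E \<delta> \<and> (\<exists>v. is_V E \<delta> v \<and> Sigma_elementary E n v)"

text \<open>
  Modal formulas over a type of atoms: \<open>nat modal\<close> are the propositional modal formulas, and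
  \<open>map_modal \<sigma> p :: 'a fm modal\<close> is the instance of \<open>p\<close> under the substitution \<open>\<sigma> :: nat \<Rightarrow> 'a fm\<close>.
\<close>

datatype 'p modal =
    Atom 'p
  | MBot
  | MImp "'p modal" "'p modal"
  | Box "'p modal"
  | Dia "'p modal"

definition MNeg :: "'p modal \<Rightarrow> 'p modal" where
  "MNeg p = MImp p MBot"

fun bool_eval :: "('p modal \<Rightarrow> bool) \<Rightarrow> 'p modal \<Rightarrow> bool" where
  "bool_eval v (Atom a) = v (Atom a)"
| "bool_eval v MBot = False"
| "bool_eval v (MImp p q) = (bool_eval v p \<longrightarrow> bool_eval v q)"
| "bool_eval v (Box p) = v (Box p)"
| "bool_eval v (Dia p) = v (Dia p)"

definition tautology :: "'p modal \<Rightarrow> bool" where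
  "tautology p \<longleftrightarrow> (\<forall>v. bool_eval v p)"

inductive_set S5 :: "nat modal set" where
  taut: "tautology p \<Longrightarrow> p \<in> S5"
| K: "MImp (Box (MImp p q)) (MImp (Box p) (Box q)) \<in> S5"
| Dual1: "MImp (Dia p) (MNeg (Box (MNeg p))) \<in> S5"
| Dual2: "MImp (MNeg (Box (MNeg p))) (Dia p) \<in> S5"
| T: "MImp (Box p) p \<in> S5"
| Four: "MImp (Box p) (Box (Box p)) \<in> S5"
| Five: "MImp (Dia (Box p)) p \<in> S5"
| MP: "MImp p q \<in> S5 \<Longrightarrow> p \<in> S5 \<Longrightarrow> q \<in> S5"
| Nec: "p \<in> S5 \<Longrightarrow> Box p \<in> S5"

fun true_at :: "('a \<Rightarrow> 'a \<Rightarrow> bool) \<Rightarrow> 'a \<Rightarrow> 'a fm modal \<Rightarrow> bool" where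
  "true_at E W (Atom \<phi>) = models E (ext E W) \<phi>"
| "true_at E W MBot = False"
| "true_at E W (MImp p q) = (true_at E W p \<longrightarrow> true_at E W q)"
| "true_at E W (Box p) = (\<forall>U. trans_set E U \<and> subset E W U \<longrightarrow> true_at E U p)"
| "true_at E W (Dia p) = (\<exists>U. trans_set E U \<and> subset E W U \<and> true_at E U p)"

definition Val :: "('a \<Rightarrow> 'a \<Rightarrow> bool) \<Rightarrow> 'a \<Rightarrow> 'a fm set \<Rightarrow> nat modal set" where
  "Val E M L = {p. \<forall>\<sigma>. range \<sigma> \<subseteq> L \<longrightarrow> true_at E M (map_modal \<sigma> p)}"

end

theory Submission
  imports Defs
begin

text \<open>
  The axiom \<open>\<diamond>\<box>p \<rightarrow> p\<close> at \<open>M\<close> is \<open>\<Sigma>\<^sub>2\<close>-elementarity of \<open>M\<close>. A true \<open>\<Sigma>\<^sub>2\<close> assertion, or a false \<open>\<Pi>\<^sub>1\<close> one, keeps its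
  truth value in all transitive sets containing a suitable witness, so it is possibly necessary and
  hence decided correctly by \<open>M\<close>. Conversely ``some \<open>W\<close> is such that \<open>\<phi>\<close> holds in every transitive
  \<open>U \<supseteq> W\<close>'' is \<open>\<Sigma>\<^sub>2\<close>, so for \<open>\<Sigma>\<^sub>2\<close>-elementary \<open>M\<close> such a \<open>W\<close> exists in \<open>M\<close>; thus every pattern of truth
  values that is possible at \<open>M\<close> stays possible, and the worlds above \<open>M\<close> behave like a universal
  Kripke model. A transitive \<open>\<Sigma>\<^sub>2\<close>-elementary \<open>M\<close> contains the power set, the rank and the \<open>V\<^sub>\<alpha>\<close>
  of its elements, so it is \<open>V\<^sub>\<delta>\<close> with \<open>\<delta> = M \<inter> Ord\<close>.

  Formulas outside S5 are refuted at every \<open>M\<close>: they fail in a finite universal Kripke model, and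
  the worlds of that model are simulated by a statement about the top of the current world whose
  value can be reset to any number by passing to a larger world.
\<close>

text \<open>The model may be ill-founded, and Separation and Replacement are available for
  first-order formulas only. So induction on sets or ordinals cannot be borrowed from HOL: each one
  runs inside the model and is paid for by a proof that its predicate is definable, which is the
  purpose of the closure rules for \<open>definable\<close>. The second obstacle is that
  \<open>Sigma_fm\<close> accepts only literal prenex formulas: a block of existential quantifiers,
  a block of universal ones, a bounded matrix. Whatever is to be found in M (power sets, ranks, the
  stages \<open>V\<^sub>\<alpha>\<close>, the collapse of a well-order, a world W) must first be
  brought into this shape. Truth in a world fits, since its quantifiers are bounded by that world.
  Both inclusions between S5 and the validities rest on one device: the worlds above any U beyond M
  realise the same set T of valuations as those above M, so that truth at U is
  \<open>ksat T\<close>. For soundness T is read off a given substitution; for refutation T is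
  prescribed and the substitution is built to realise it.\<close>

section \<open>Completeness of S5 for finite universal models\<close>

text \<open>The worlds of the universal model are valuations, so a model is a set \<open>T\<close> of valuations.\<close>

fun ksat :: "(nat \<Rightarrow> bool) set \<Rightarrow> (nat \<Rightarrow> bool) \<Rightarrow> nat modal \<Rightarrow> bool" where
  "ksat T v (Atom n) = v n"
| "ksat T v MBot = False"
| "ksat T v (MImp p q) = (ksat T v p \<longrightarrow> ksat T v q)"
| "ksat T v (Box p) = (\<forall>u\<in>T. ksat T u p)"
| "ksat T v (Dia p) = (\<exists>u\<in>T. ksat T u p)"

text \<open>\<open>bool_eval\<close> treats boxed and diamond formulas as atoms, so truth at v is
  one of the valuations that a tautology survives.\<close>

lemma bool_eval_ksat: "bool_eval (ksat T v) p = ksat T v p"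
  by (induction p) auto

lemma S5_sound: "p \<in> S5 \<Longrightarrow> v \<in> T \<Longrightarrow> ksat T v p"
proof (induction arbitrary: v rule: S5.induct)
  case (taut p)
  then show ?case using bool_eval_ksat unfolding tautology_def by blast
qed (auto simp: MNeg_def)

section \<open>Derivability from assumptions and maximal consistent sets\<close>

text \<open>Necessitation enters only through \<open>ax\<close>, for theorems of S5; applied to
  assumptions it would destroy the deduction theorem.\<close>

inductive S5_derives :: "nat modal set \<Rightarrow> nat modal \<Rightarrow> bool" for G where
  asm: "p \<in> G \<Longrightarrow> S5_derives G p"
| ax: "p \<in> S5 \<Longrightarrow> S5_derives G p"
| mp: "S5_derives G (MImp p q) \<Longrightarrow> S5_derives G p \<Longrightarrow> S5_derives G q"

lemma S5_derives_taut: "tautology p \<Longrightarrow> S5_derives G p"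
  by (intro S5_derives.ax S5.taut)

lemma S5_derives_mono: "S5_derives G p \<Longrightarrow> G \<subseteq> H \<Longrightarrow> S5_derives H p"
proof (induction rule: S5_derives.induct)
  case (mp p q)
  then show ?case by (auto intro: S5_derives.mp[of _ p])
qed (auto intro: S5_derives.asm S5_derives.ax)

lemma S5_derives_empty: "S5_derives {} p \<Longrightarrow> p \<in> S5"
proof (induction rule: S5_derives.induct)
  case (mp p q)
  show ?case by (rule S5.MP[OF mp.IH])
qed auto

lemma S5_deduction: "S5_derives (insert q G) p \<Longrightarrow> S5_derives G (MImp q p)"
proof (induction rule: S5_derives.induct)
  case (asm p)
  show ?case
  proof (cases "p = q")
    case True
    then show ?thesis by (auto intro!: S5_derives_taut simp: tautology_def)
  next
    case False
    with asm have "S5_derives G p" by (auto intro: S5_derives.asm)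
    moreover have "S5_derives G (MImp p (MImp q p))"
      by (auto intro!: S5_derives_taut simp: tautology_def)
    ultimately show ?thesis by (rule S5_derives.mp[rotated])
  qed
next
  case (ax p)
  have "S5_derives G (MImp p (MImp q p))"
    by (auto intro!: S5_derives_taut simp: tautology_def)
  from S5_derives.mp[OF this S5_derives.ax[OF ax]] show ?case .
next
  case (mp p r)
  have "S5_derives G (MImp (MImp q (MImp p r)) (MImp (MImp q p) (MImp q r)))"
    by (auto intro!: S5_derives_taut simp: tautology_def)
  from S5_derives.mp[OF S5_derives.mp[OF this mp.IH(1)] mp.IH(2)] show ?case .
qed

text \<open>A derivation uses finitely many assumptions: the premises of \<open>mp\<close> come from
  two members of the chain, and the larger one serves for both. For an axiom any member will do,
  hence C is non-empty.\<close>

lemma S5_derives_chain: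
  "S5_derives (\<Union>C) p \<Longrightarrow> C \<in> chains A \<Longrightarrow> C \<noteq> {} \<Longrightarrow> \<exists>G\<in>C. S5_derives G p"
proof (induction rule: S5_derives.induct)
  case (asm p)
  then show ?case by (blast intro: S5_derives.asm)
next
  case (ax p)
  then show ?case by (blast intro: S5_derives.ax)
next
  case (mp p q)
  then obtain G H where GH: "G \<in> C" "S5_derives G (MImp p q)" "H \<in> C" "S5_derives H p" by blast
  then have "G \<subseteq> H \<or> H \<subseteq> G" using mp.prems unfolding chains_def chain_subset_def by blast
  then show ?case
  proof
    assume "G \<subseteq> H"
    with GH show ?thesis by (blast intro: S5_derives.mp[of H p] S5_derives_mono[of G])
  next
    assume "H \<subseteq> G"
    with GH show ?thesis by (blast intro: S5_derives.mp[of G p] S5_derives_mono[of H])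
  qed
qed

definition mcs :: "nat modal set \<Rightarrow> bool" where
  "mcs G \<longleftrightarrow> \<not> S5_derives G MBot \<and> (\<forall>p. p \<notin> G \<longrightarrow> S5_derives (insert p G) MBot)"

lemma lindenbaum:
  assumes "\<not> S5_derives G MBot"
  shows "\<exists>H. G \<subseteq> H \<and> mcs H"
proof -
  let ?A = "{H. G \<subseteq> H \<and> \<not> S5_derives H MBot}"
  have "\<exists>U\<in>?A. \<forall>X\<in>C. X \<subseteq> U" if C: "C \<in> chains ?A" for C
  proof (cases "C = {}")
    case True
    \<comment> \<open>The union of the empty chain need not contain G; here G itself is the
      bound.\<close>
    then show ?thesis using assms by auto
  next
    case False
    have sub: "C \<subseteq> ?A" using C unfolding chains_def by blast
    have "\<not> S5_derives (\<Union>C) MBot"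
    proof
      assume "S5_derives (\<Union>C) MBot"
      from S5_derives_chain[OF this C False] sub show False by auto
    qed
    moreover have "G \<subseteq> \<Union>C" using sub False by blast
    ultimately show ?thesis by blast
  qed
  then have "\<exists>H\<in>?A. \<forall>X\<in>?A. H \<subseteq> X \<longrightarrow> X = H"
    by (intro Zorn_Lemma2 ballI)
  then obtain H where H: "H \<in> ?A" and max: "\<forall>X\<in>?A. H \<subseteq> X \<longrightarrow> X = H"
    by (elim bexE)
  have "S5_derives (insert p H) MBot" if "p \<notin> H" for p
  proof (rule ccontr)
    assume "\<not> S5_derives (insert p H) MBot"
    with H have "insert p H \<in> ?A" by auto
    then have "insert p H = H" using max by blast
    then show False using that by blast
  qed
  with H show ?thesis unfolding mcs_def by blast
qed

text \<open>Were p missing, adding it would be inconsistent; by the deduction theorem G would then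
  refute p as well as derive it.\<close>

lemma mcs_derives: "mcs G \<Longrightarrow> S5_derives G p \<Longrightarrow> p \<in> G"
  using S5_derives.mp[OF S5_deduction] unfolding mcs_def by blast

lemma mcs_S5: "mcs G \<Longrightarrow> p \<in> S5 \<Longrightarrow> p \<in> G"
  by (simp add: mcs_derives S5_derives.ax)

lemma mcs_mp: "mcs G \<Longrightarrow> MImp p q \<in> G \<Longrightarrow> p \<in> G \<Longrightarrow> q \<in> G"
  by (rule mcs_derives) (auto intro: S5_derives.mp[of _ p] S5_derives.asm)

lemma mcs_bot: "mcs G \<Longrightarrow> MBot \<notin> G"
  unfolding mcs_def using S5_derives.asm by blast

lemma mcs_neg:
  assumes G: "mcs G"
  shows "MNeg p \<in> G \<longleftrightarrow> p \<notin> G"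
proof
  from G show "MNeg p \<in> G \<Longrightarrow> p \<notin> G" unfolding MNeg_def using mcs_mp[of G p MBot] mcs_bot[of G] by blast
  assume "p \<notin> G"
  with G have "S5_derives (insert p G) MBot" unfolding mcs_def by blast
  with G show "MNeg p \<in> G" unfolding MNeg_def by (intro mcs_derives S5_deduction)
qed

lemma mcs_imp:
  assumes G: "mcs G"
  shows "MImp p q \<in> G \<longleftrightarrow> (p \<in> G \<longrightarrow> q \<in> G)"
proof
  assume h: "p \<in> G \<longrightarrow> q \<in> G"
  have "MImp (MNeg p) (MImp p q) \<in> G" "MImp q (MImp p q) \<in> G"
    by (auto intro!: mcs_S5[OF G] S5.taut simp: tautology_def MNeg_def)
  then show "MImp p q \<in> G" 
    using h mcs_mp[OF G, of "MNeg p" "MImp p q"] mcs_mp[OF G, of q "MImp p q"] mcs_neg[OF G, of p] by blast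
qed (use mcs_mp[OF G, of p q] in simp)

lemma mcs_dia:
  assumes G: "mcs G"
  shows "Dia p \<in> G \<longleftrightarrow> Box (MNeg p) \<notin> G"
  using mcs_S5[OF G S5.Dual1[of p]] mcs_S5[OF G S5.Dual2[of p]]
  by (auto simp: mcs_imp[OF G] mcs_neg[OF G])

text \<open>Put a box in front of every line of the derivation: assumptions are boxed in G, theorems
  are necessitated, and K simulates modus ponens.\<close>

lemma S5_derives_box: "S5_derives {p. Box p \<in> G} q \<Longrightarrow> S5_derives G (Box q)"
proof (induction rule: S5_derives.induct)
  case (mp p q)
  show ?case by (rule S5_derives.mp[OF S5_derives.mp[OF S5_derives.ax[OF S5.K] mp.IH(1)] mp.IH(2)])
qed (auto intro: S5_derives.asm S5_derives.ax S5.Nec)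

text \<open>The usual successor in the canonical model. By Four and Five it has exactly the boxed
  formulas of G, so the points reachable from G form a cluster in which any two see each
  other.\<close>

lemma mcs_box_witness:
  assumes G: "mcs G" and q: "Box q \<notin> G"
  shows "\<exists>H. mcs H \<and> q \<notin> H \<and> (\<forall>p. Box p \<in> H \<longleftrightarrow> Box p \<in> G)"
proof -
  have "\<not> S5_derives (insert (MNeg q) {p. Box p \<in> G}) MBot"
  proof
    assume "S5_derives (insert (MNeg q) {p. Box p \<in> G}) MBot"
    then have "S5_derives {p. Box p \<in> G} (MImp (MNeg q) MBot)" by (rule S5_deduction)
    moreover have "S5_derives {p. Box p \<in> G} (MImp (MImp (MNeg q) MBot) q)"
      by (auto intro!: S5_derives_taut simp: tautology_def MNeg_def)
    ultimately have "S5_derives {p. Box p \<in> G} q" by (rule S5_derives.mp[rotated])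
    then show False using S5_derives_box mcs_derives[OF G] q by blast
  qed
  then obtain H where H: "mcs H" and sub: "insert (MNeg q) {p. Box p \<in> G} \<subseteq> H"
    using lindenbaum by blast
  have "Box p \<in> H \<longleftrightarrow> Box p \<in> G" for p
  proof
    assume "Box p \<in> G"
    then have "Box (Box p) \<in> G" by (rule mcs_mp[OF G mcs_S5[OF G S5.Four]])
    then show "Box p \<in> H" using sub by blast
  next
    assume "Box p \<in> H"
    then have "Box (Box p) \<in> H" by (rule mcs_mp[OF H mcs_S5[OF H S5.Four]])
    \<comment> \<open>Otherwise H would contain \<open>MNeg (Box (Box p))\<close>. What follows is
      Five for the formula \<open>Box p\<close>.\<close>
    then have "Box (MNeg (Box (Box p))) \<notin> G" using sub mcs_neg[OF H] by blast
    then have "Dia (Box (Box p)) \<in> G" by (simp add: mcs_dia[OF G])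
    then show "Box p \<in> G" by (rule mcs_mp[OF G mcs_S5[OF G S5.Five]])
  qed
  then show ?thesis using H sub mcs_neg[OF H] by blast
qed

lemma S5_complete:
  assumes "p \<notin> S5"
  shows "\<exists>T v. v \<in> T \<and> \<not> ksat T v p"
proof -
  have "\<not> S5_derives (insert (MNeg p) {}) MBot"
  proof
    assume "S5_derives (insert (MNeg p) {}) MBot"
    then have "MImp (MNeg p) MBot \<in> S5" by (intro S5_derives_empty S5_deduction)
    moreover have "MImp (MImp (MNeg p) MBot) p \<in> S5"
      by (auto intro!: S5.taut simp: tautology_def MNeg_def)
    ultimately show False using S5.MP assms by blast
  qed
  then obtain G where G: "mcs G" "MNeg p \<in> G" using lindenbaum by blast
  \<comment> \<open>C is the cluster of G. In a universal model only the valuation of a point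
    matters, so C may be replaced by its image under w.\<close>
  define C where "C = {H. mcs H \<and> (\<forall>q. Box q \<in> H \<longleftrightarrow> Box q \<in> G)}"
  define w where "w H = (\<lambda>n. Atom n \<in> H)" for H :: "nat modal set"
  have mcs: "mcs H" if "H \<in> C" for H using that by (simp add: C_def)
  have box: "Box q \<in> H \<longleftrightarrow> (\<forall>K\<in>C. q \<in> K)" if H: "H \<in> C" for H q
  proof
    assume q: "Box q \<in> H"
    show "\<forall>K\<in>C. q \<in> K"
    proof
      fix K assume K: "K \<in> C"
      with q H have "Box q \<in> K" by (simp add: C_def)
      then show "q \<in> K" using mcs_mp[OF mcs[OF K] mcs_S5[OF mcs[OF K] S5.T]] by simp
    qed
  next
    assume q: "\<forall>K\<in>C. q \<in> K"
    show "Box q \<in> H"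
    proof (rule ccontr)
      assume "Box q \<notin> H"
      then obtain K where "mcs K" "q \<notin> K" "\<forall>p. Box p \<in> K \<longleftrightarrow> Box p \<in> H"
        using mcs_box_witness[OF mcs[OF H]] by blast
      then show False using q H by (simp add: C_def)
    qed
  qed
  have truth: "H \<in> C \<Longrightarrow> ksat (w ` C) (w H) q \<longleftrightarrow> q \<in> H" for H q
  proof (induction q arbitrary: H)
    case (Atom n)
    then show ?case by (simp add: w_def)
  next
    case MBot
    then show ?case using mcs_bot mcs by auto
  next
    case (MImp q r)
    then show ?case using mcs_imp mcs by auto
  next
    case (Box q)
    then show ?case by (simp add: box)
  next
    case (Dia q)
    have "Dia q \<in> H \<longleftrightarrow> (\<exists>K\<in>C. MNeg q \<notin> K)"
      using box[OF Dia.prems] mcs_dia[OF mcs[OF Dia.prems]] by simp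
    also have "\<dots> \<longleftrightarrow> (\<exists>K\<in>C. q \<in> K)" using mcs_neg mcs by blast
    finally show ?case using Dia.IH by simp
  qed
  have "G \<in> C" using G unfolding C_def by blast
  moreover have "p \<notin> G" using G mcs_neg by blast
  ultimately have "w G \<in> w ` C" "\<not> ksat (w ` C) (w G) p" using truth by auto
  then show ?thesis by blast
qed

lemma ksat_restrict:
  assumes "set_modal p \<subseteq> A"
  shows "ksat ((\<lambda>u n. n \<in> A \<and> u n) ` T) (\<lambda>n. n \<in> A \<and> v n) p \<longleftrightarrow> ksat T v p"
  using assms by (induction p arbitrary: v) auto

text \<open>Valuations cut down to the finitely many atoms of p are finite in number. Finiteness of
  T is what later allows its members to be coded by numbers up to a bound.\<close>

lemma S5_complete_finite:
  assumes "p \<notin> S5"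
  shows "\<exists>T v. finite T \<and> v \<in> T \<and> \<not> ksat T v p"
proof -
  obtain T v where T: "v \<in> T" "\<not> ksat T v p" using S5_complete[OF assms] by blast
  define r where "r = (\<lambda>(u :: nat \<Rightarrow> bool) n. n \<in> set_modal p \<and> u n)"
  have "finite (set_modal p)" by (induction p) auto
  moreover have "r ` T \<subseteq> (\<lambda>X n. n \<in> X) ` Pow (set_modal p)"
  proof
    fix u assume "u \<in> r ` T"
    then obtain u' where "u = r u'" by blast
    then have "u = (\<lambda>n. n \<in> {n \<in> set_modal p. u' n})" by (auto simp: r_def)
    then show "u \<in> (\<lambda>X n. n \<in> X) ` Pow (set_modal p)" by blast
  qed
  ultimately have "finite (r ` T)" by (meson finite_Pow_iff finite_imageI finite_subset)
  moreover have "\<not> ksat (r ` T) (r v) p"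
    using T(2) ksat_restrict[of p "set_modal p" T v] unfolding r_def by simp
  ultimately show ?thesis using T(1) by blast
qed

section \<open>First-order formulas\<close>

lemma val_cong: "(\<And>n. n \<in> fv_trm t \<Longrightarrow> e n = e' n) \<Longrightarrow> val e t = val e' t"
  by (cases t) auto

lemma sat_cong: "(\<And>n. n \<in> fv \<phi> \<Longrightarrow> e n = e' n) \<Longrightarrow> sat E D e \<phi> = sat E D e' \<phi>"
proof (induction \<phi> arbitrary: e e')
  case (FMem s t)
  have "val e s = val e' s" "val e t = val e' t" by (auto intro!: val_cong FMem)
  then show ?case by simp
next
  case (FEq s t)
  have "val e s = val e' s" "val e t = val e' t" by (auto intro!: val_cong FEq)
  then show ?case by simp
next
  case (FNeg \<phi>)
  have "sat E D e \<phi> = sat E D e' \<phi>" by (auto intro!: FNeg)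
  then show ?case by simp
next
  case (FAnd \<phi> \<psi>)
  have "sat E D e \<phi> = sat E D e' \<phi>" "sat E D e \<psi> = sat E D e' \<psi>" by (auto intro!: FAnd)
  then show ?case by simp
next
  case (FEx n \<phi>)
  have "sat E D (e(n := x)) \<phi> = sat E D (e'(n := x)) \<phi>" for x
    by (rule FEx.IH) (auto intro!: FEx.prems)
  then show ?case by simp
next
  case (FAll n \<phi>)
  have "sat E D (e(n := x)) \<phi> = sat E D (e'(n := x)) \<phi>" for x
    by (rule FAll.IH) (auto intro!: FAll.prems)
  then show ?case by simp
qed

lemma models_sentence: "fv \<phi> = {} \<Longrightarrow> models E D \<phi> \<longleftrightarrow> sat E D e \<phi>"
  unfolding models_def using sat_cong[of \<phi>] by blast

lemma models_neg: "fv \<phi> = {} \<Longrightarrow> models E D (FNeg \<phi>) \<longleftrightarrow> \<not> models E D \<phi>"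
  by (simp add: models_sentence[of _ E D undefined])

lemma models_and: "models E D (FAnd \<phi> \<psi>) \<longleftrightarrow> models E D \<phi> \<and> models E D \<psi>"
  by (auto simp: models_def)

lemma lang_neg: "FNeg \<phi> \<in> lang E A \<longleftrightarrow> \<phi> \<in> lang E A"
  by (simp add: lang_def)

lemma lang_and: "FAnd \<phi> \<psi> \<in> lang E A \<longleftrightarrow> \<phi> \<in> lang E A \<and> \<psi> \<in> lang E A"
  by (auto simp: lang_def)

fun sub_trm :: "(nat \<Rightarrow> 'a trm) \<Rightarrow> 'a trm \<Rightarrow> 'a trm" where
  "sub_trm s (Var n) = s n"
| "sub_trm s (Par a) = Par a"

lemma val_sub_trm: "val e (sub_trm s t) = val (\<lambda>n. val e (s n)) t"
  by (cases t) auto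

lemma fv_sub_trm: "(\<And>n. fv_trm (s n) \<subseteq> B) \<Longrightarrow> fv_trm (sub_trm s t) \<subseteq> B"
  by (cases t) auto

lemma set_sub_trm:
  "(\<And>n. set_trm (s n) \<subseteq> B) \<Longrightarrow> set_trm t \<subseteq> B \<Longrightarrow> set_trm (sub_trm s t) \<subseteq> B"
  by (cases t) auto

text \<open>Only for \<open>s\<close> sending each variable to itself or to a parameter: no renaming of bound variables.\<close>

fun sub :: "(nat \<Rightarrow> 'a trm) \<Rightarrow> 'a fm \<Rightarrow> 'a fm" where
  "sub s (FMem t u) = FMem (sub_trm s t) (sub_trm s u)"
| "sub s (FEq t u) = FEq (sub_trm s t) (sub_trm s u)"
| "sub s (FNeg \<phi>) = FNeg (sub s \<phi>)"
| "sub s (FAnd \<phi> \<psi>) = FAnd (sub s \<phi>) (sub s \<psi>)"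
| "sub s (FEx n \<phi>) = FEx n (sub (s(n := Var n)) \<phi>)"
| "sub s (FAll n \<phi>) = FAll n (sub (s(n := Var n)) \<phi>)"

lemma val_upd_sub:
  assumes "\<And>m. fv_trm (s m) \<subseteq> {m}"
  shows "(\<lambda>m. val (e(n := x)) ((s(n := Var n)) m)) = (\<lambda>m. val e (s m))(n := x)"
proof
  fix m
  show "val (e(n := x)) ((s(n := Var n)) m) = ((\<lambda>m. val e (s m))(n := x)) m"
    using assms[of m] by (cases "s m") auto
qed

lemma sat_sub:
  "(\<And>m. fv_trm (s m) \<subseteq> {m}) \<Longrightarrow> sat E D e (sub s \<phi>) = sat E D (\<lambda>m. val e (s m)) \<phi>"
proof (induction \<phi> arbitrary: e s)
  case (FEx n \<phi>)
  have "sat E D (e(n := x)) (sub (s(n := Var n)) \<phi>) = sat E D ((\<lambda>m. val e (s m))(n := x)) \<phi>" for x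
    unfolding val_upd_sub[OF FEx.prems, symmetric] using FEx.prems by (intro FEx.IH) simp
  then show ?case by simp
next
  case (FAll n \<phi>)
  have "sat E D (e(n := x)) (sub (s(n := Var n)) \<phi>) = sat E D ((\<lambda>m. val e (s m))(n := x)) \<phi>" for x
    unfolding val_upd_sub[OF FAll.prems, symmetric] using FAll.prems by (intro FAll.IH) simp
  then show ?case by simp
qed (auto simp: val_sub_trm)

lemma fv_sub: "(\<And>m. m \<in> fv \<phi> \<Longrightarrow> fv_trm (s m) \<subseteq> B) \<Longrightarrow> fv (sub s \<phi>) \<subseteq> B"
proof (induction \<phi> arbitrary: s B)
  case (FMem t u)
  then show ?case by (cases t; cases u) auto
next
  case (FEq t u)
  then show ?case by (cases t; cases u) auto
next
  case (FEx n \<phi>)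
  have "fv (sub (s(n := Var n)) \<phi>) \<subseteq> insert n B"
    using FEx.prems by (intro FEx.IH) (auto split: if_splits)
  then show ?case by auto
next
  case (FAll n \<phi>)
  have "fv (sub (s(n := Var n)) \<phi>) \<subseteq> insert n B"
    using FAll.prems by (intro FAll.IH) (auto split: if_splits)
  then show ?case by auto
qed auto

lemma params_sub:
  "(\<And>m. m \<in> fv \<phi> \<Longrightarrow> set_trm (s m) \<subseteq> B) \<Longrightarrow> params \<phi> \<subseteq> B \<Longrightarrow> params (sub s \<phi>) \<subseteq> B"
proof (induction \<phi> arbitrary: s)
  case (FMem t u)
  then show ?case by (cases t; cases u) auto
next
  case (FEq t u)
  then show ?case by (cases t; cases u) auto
next
  case (FEx n \<phi>)
  have "params (sub (s(n := Var n)) \<phi>) \<subseteq> B"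
    using FEx.prems by (intro FEx.IH) (auto split: if_splits)
  then show ?case by auto
next
  case (FAll n \<phi>)
  have "params (sub (s(n := Var n)) \<phi>) \<subseteq> B"
    using FAll.prems by (intro FAll.IH) (auto split: if_splits)
  then show ?case by auto
qed auto

text \<open>The assignment is frozen into parameters. One sentence works for all domains at once, as
  a substitution must be fixed before the worlds vary.\<close>

lemma close_fm:
  assumes "params \<phi> \<subseteq> ext E A" and "\<And>n. n \<in> fv \<phi> \<Longrightarrow> E (e n) A"
  shows "\<exists>\<psi>\<in>lang E A. \<forall>D. models E D \<psi> \<longleftrightarrow> sat E D e \<phi>"
proof (intro bexI allI)
  let ?\<psi> = "sub (\<lambda>n. Par (e n)) \<phi>"
  have fv: "fv ?\<psi> = {}" using fv_sub[of \<phi> "\<lambda>n. Par (e n)" "{}"] by auto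
  then show "?\<psi> \<in> lang E A"
    using assms params_sub[of \<phi> "\<lambda>n. Par (e n)" "ext E A"] by (auto simp: lang_def ext_def)
  show "models E D ?\<psi> \<longleftrightarrow> sat E D e \<phi>" for D
    by (simp add: models_sentence[OF fv, of E D e] sat_sub)
qed

section \<open>Definability\<close>

text \<open>
  In \<open>db\<close> the variables are de Bruijn indices, so that definability of a predicate under a quantifier
  is definability of its body in the extended environment; \<open>DBEx t\<close> is the quantifier bounded by \<open>t\<close>.
\<close>

datatype 'a db =
    DMem "'a trm" "'a trm"
  | DEq "'a trm" "'a trm"
  | DNeg "'a db"
  | DAnd "'a db" "'a db"
  | DBEx "'a trm" "'a db"
  | DEx "'a db"
  | DAll "'a db"

fun dsat :: "('a \<Rightarrow> 'a \<Rightarrow> bool) \<Rightarrow> 'a set \<Rightarrow> (nat \<Rightarrow> 'a) \<Rightarrow> 'a db \<Rightarrow> bool" where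
  "dsat E D e (DMem s t) = E (val e s) (val e t)"
| "dsat E D e (DEq s t) = (val e s = val e t)"
| "dsat E D e (DNeg \<phi>) = (\<not> dsat E D e \<phi>)"
| "dsat E D e (DAnd \<phi> \<psi>) = (dsat E D e \<phi> \<and> dsat E D e \<psi>)"
| "dsat E D e (DBEx t \<phi>) = (\<exists>x\<in>D. E x (val e t) \<and> dsat E D (case_nat x e) \<phi>)"
| "dsat E D e (DEx \<phi>) = (\<exists>x\<in>D. dsat E D (case_nat x e) \<phi>)"
| "dsat E D e (DAll \<phi>) = (\<forall>x\<in>D. dsat E D (case_nat x e) \<phi>)"

text \<open>The index \<open>i\<close> becomes the term \<open>s i\<close>, and \<open>d, d + 1, \<dots>\<close> are the names of the bound variables.\<close>

fun to_fm :: "nat \<Rightarrow> (nat \<Rightarrow> 'a trm) \<Rightarrow> 'a db \<Rightarrow> 'a fm" where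
  "to_fm d s (DMem t u) = FMem (sub_trm s t) (sub_trm s u)"
| "to_fm d s (DEq t u) = FEq (sub_trm s t) (sub_trm s u)"
| "to_fm d s (DNeg \<phi>) = FNeg (to_fm d s \<phi>)"
| "to_fm d s (DAnd \<phi> \<psi>) = FAnd (to_fm d s \<phi>) (to_fm d s \<psi>)"
| "to_fm d s (DBEx t \<phi>) =
    FEx d (FAnd (FMem (Var d) (sub_trm s t)) (to_fm (Suc d) (case_nat (Var d) s) \<phi>))"
| "to_fm d s (DEx \<phi>) = FEx d (to_fm (Suc d) (case_nat (Var d) s) \<phi>)"
| "to_fm d s (DAll \<phi>) = FAll d (to_fm (Suc d) (case_nat (Var d) s) \<phi>)"

definition fresh_from :: "nat \<Rightarrow> (nat \<Rightarrow> 'a trm) \<Rightarrow> bool" where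
  "fresh_from d s \<longleftrightarrow> (\<forall>i. fv_trm (s i) \<subseteq> {..<d})"

lemma fresh_from_Suc: "fresh_from d s \<Longrightarrow> fresh_from (Suc d) (case_nat (Var d) s)"
  by (force simp: fresh_from_def split: nat.splits)

lemma fresh_from_Par: "fresh_from 0 (\<lambda>i. Par (e i))"
  by (simp add: fresh_from_def)

lemma val_fresh: "fresh_from d s \<Longrightarrow> val (e(d := x)) (s i) = val e (s i)"
  by (rule val_cong) (auto simp: fresh_from_def)

lemma val_case_fresh:
  "fresh_from d s \<Longrightarrow>
    (\<lambda>i. val (e(d := x)) (case_nat (Var d) s i)) = case_nat x (\<lambda>i. val e (s i))"
  by (rule ext) (simp add: val_fresh split: nat.splits)

lemma sat_to_fm: "fresh_from d s \<Longrightarrow> sat E D e (to_fm d s \<phi>) = dsat E D (\<lambda>i. val e (s i)) \<phi>"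
proof (induction \<phi> arbitrary: d s e)
  case (DBEx t \<phi>)
  have "sat E D (e(d := x)) (to_fm (Suc d) (case_nat (Var d) s) \<phi>) =
      dsat E D (case_nat x (\<lambda>i. val e (s i))) \<phi>" for x
    using DBEx.IH[OF fresh_from_Suc[OF DBEx.prems]] val_case_fresh[OF DBEx.prems] by metis
  then show ?case using val_fresh[OF DBEx.prems] by (simp add: val_sub_trm)
next
  case (DEx \<phi>)
  have "sat E D (e(d := x)) (to_fm (Suc d) (case_nat (Var d) s) \<phi>) =
      dsat E D (case_nat x (\<lambda>i. val e (s i))) \<phi>" for x
    using DEx.IH[OF fresh_from_Suc[OF DEx.prems]] val_case_fresh[OF DEx.prems] by metis
  then show ?case by simp
next
  case (DAll \<phi>)
  have "sat E D (e(d := x)) (to_fm (Suc d) (case_nat (Var d) s) \<phi>) =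
      dsat E D (case_nat x (\<lambda>i. val e (s i))) \<phi>" for x
    using DAll.IH[OF fresh_from_Suc[OF DAll.prems]] val_case_fresh[OF DAll.prems] by metis
  then show ?case by simp
qed (auto simp: val_sub_trm)

lemma fv_to_fm: "fresh_from d s \<Longrightarrow> fv (to_fm d s \<phi>) \<subseteq> {..<d}"
proof (induction \<phi> arbitrary: d s)
  case (DBEx t \<phi>)
  have "fv_trm (sub_trm s t) \<subseteq> {..<d}"
    using DBEx.prems by (intro fv_sub_trm) (simp add: fresh_from_def)
  then show ?case using DBEx.IH[OF fresh_from_Suc[OF DBEx.prems]] by (auto simp: less_Suc_eq)
next
  case (DEx \<phi>)
  then show ?case using DEx.IH[OF fresh_from_Suc[OF DEx.prems]] by (auto simp: less_Suc_eq)
next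
  case (DAll \<phi>)
  then show ?case using DAll.IH[OF fresh_from_Suc[OF DAll.prems]] by (auto simp: less_Suc_eq)
next
  case (DMem t u)
  then show ?case using fv_sub_trm[of s "{..<d}"] by (simp add: fresh_from_def)
next
  case (DEq t u)
  then show ?case using fv_sub_trm[of s "{..<d}"] by (simp add: fresh_from_def)
qed auto

lemma params_to_fm:
  "(\<And>i. set_trm (s i) \<subseteq> B) \<Longrightarrow> set_db \<phi> \<subseteq> B \<Longrightarrow> params (to_fm d s \<phi>) \<subseteq> B"
proof (induction \<phi> arbitrary: d s)
  case (DMem t u)
  then show ?case by (simp add: set_sub_trm)
next
  case (DEq t u)
  then show ?case by (simp add: set_sub_trm)
next
  case (DBEx t \<phi>)
  have "params (to_fm (Suc d) (case_nat (Var d) s) \<phi>) \<subseteq> B"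
    using DBEx.prems by (intro DBEx.IH) (auto split: nat.split)
  then show ?case using DBEx.prems by (simp add: set_sub_trm)
next
  case (DEx \<phi>)
  have "params (to_fm (Suc d) (case_nat (Var d) s) \<phi>) \<subseteq> B"
    using DEx.prems by (intro DEx.IH) (auto split: nat.split)
  then show ?case by simp
next
  case (DAll \<phi>)
  have "params (to_fm (Suc d) (case_nat (Var d) s) \<phi>) \<subseteq> B"
    using DAll.prems by (intro DAll.IH) (auto split: nat.split)
  then show ?case by simp
qed auto

fun db_bounded :: "'a db \<Rightarrow> bool" where
  "db_bounded (DNeg \<phi>) = db_bounded \<phi>"
| "db_bounded (DAnd \<phi> \<psi>) = (db_bounded \<phi> \<and> db_bounded \<psi>)"
| "db_bounded (DBEx t \<phi>) = db_bounded \<phi>"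
| "db_bounded (DEx \<phi>) = False"
| "db_bounded (DAll \<phi>) = False"
| "db_bounded _ = True"

fun db_Pi1 :: "'a db \<Rightarrow> bool" where
  "db_Pi1 (DAll \<phi>) = db_Pi1 \<phi>"
| "db_Pi1 \<phi> = db_bounded \<phi>"

fun db_Sigma2 :: "'a db \<Rightarrow> bool" where
  "db_Sigma2 (DEx \<phi>) = db_Sigma2 \<phi>"
| "db_Sigma2 \<phi> = db_Pi1 \<phi>"

lemma Delta0_to_fm: "db_bounded \<phi> \<Longrightarrow> fresh_from d s \<Longrightarrow> Delta0_fm (to_fm d s \<phi>)"
proof (induction \<phi> arbitrary: d s rule: db_bounded.induct)
  case (3 t \<phi>)
  have "fv_trm (sub_trm s t) \<subseteq> {..<d}"
    using 3 by (intro fv_sub_trm) (simp add: fresh_from_def)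
  \<comment> \<open>Freshness of d yields the side condition of \<open>Delta0_fm\<close> that the
    bound is not the quantified variable.\<close>
  then have "sub_trm s t \<noteq> Var d" by auto
  then show ?case using 3 by (simp add: Delta0_fm.intros(5) fresh_from_Suc)
qed (auto intro: Delta0_fm.intros)

lemma Pi1_to_fm: "db_Pi1 \<phi> \<Longrightarrow> fresh_from d s \<Longrightarrow> Pi_fm (Suc 0) (to_fm d s \<phi>)"
proof (induction \<phi> arbitrary: d s)
  case (DAll \<phi>)
  then show ?case by (simp add: Sigma_fm_Pi_fm.intros(6) fresh_from_Suc)
qed (auto intro!: Sigma_fm_Pi_fm.intros Delta0_to_fm simp del: to_fm.simps)

lemma Sigma2_to_fm: "db_Sigma2 \<phi> \<Longrightarrow> fresh_from d s \<Longrightarrow> Sigma_fm 2 (to_fm d s \<phi>)"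
  unfolding numeral_2_eq_2
proof (induction \<phi> arbitrary: d s)
  case (DEx \<phi>)
  then show ?case by (simp add: Sigma_fm_Pi_fm.intros(4) fresh_from_Suc)
qed (auto intro: Sigma_fm_Pi_fm.intros(3) Pi1_to_fm simp del: to_fm.simps db_Pi1.simps)

text \<open>For \<open>b = True\<close> only bounded quantifiers are allowed.\<close>

definition definable ::
  "('a \<Rightarrow> 'a \<Rightarrow> bool) \<Rightarrow> bool \<Rightarrow> 'a set \<Rightarrow> ((nat \<Rightarrow> 'a) \<Rightarrow> bool) \<Rightarrow> bool" where
  "definable E b A P \<longleftrightarrow>
    (\<exists>\<psi>. (b \<longrightarrow> db_bounded \<psi>) \<and> set_db \<psi> \<subseteq> A \<and> (\<forall>e. dsat E UNIV e \<psi> \<longleftrightarrow> P e))"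

lemma definable_mem: "definable E b A (\<lambda>e. E (e i) (e j))"
  unfolding definable_def by (rule exI[of _ "DMem (Var i) (Var j)"]) simp

lemma definable_eq: "definable E b A (\<lambda>e. e i = e j)"
  unfolding definable_def by (rule exI[of _ "DEq (Var i) (Var j)"]) simp

lemma definable_not: "definable E b A P \<Longrightarrow> definable E b A (\<lambda>e. \<not> P e)"
  unfolding definable_def by (elim exE, rule_tac x = "DNeg \<psi>" in exI) auto

lemma definable_and:
  "definable E b A P \<Longrightarrow> definable E b A Q \<Longrightarrow> definable E b A (\<lambda>e. P e \<and> Q e)"
  unfolding definable_def by (elim exE, rule_tac x = "DAnd \<psi> \<psi>'" in exI) auto

lemma definable_or:
  "definable E b A P \<Longrightarrow> definable E b A Q \<Longrightarrow> definable E b A (\<lambda>e. P e \<or> Q e)"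
  using definable_not[OF definable_and[OF definable_not definable_not], of E b A P Q] by simp

lemma definable_imp:
  "definable E b A P \<Longrightarrow> definable E b A Q \<Longrightarrow> definable E b A (\<lambda>e. P e \<longrightarrow> Q e)"
  unfolding imp_conv_disj by (intro definable_or definable_not)

lemma definable_iff:
  "definable E b A P \<Longrightarrow> definable E b A Q \<Longrightarrow> definable E b A (\<lambda>e. P e \<longleftrightarrow> Q e)"
  unfolding iff_conv_conj_imp by (intro definable_and definable_imp)

text \<open>In the hypothesis index 0 is the bound variable and the old index n has become
  \<open>Suc n\<close>. Stated as higher-order patterns, the quantifier rules let
  \<open>intro\<close> work through a predicate directly.\<close>

lemma definable_bex:
  assumes "definable E b A (\<lambda>e. P (\<lambda>n. e (Suc n)) (e 0))"
  shows "definable E b A (\<lambda>e. \<exists>x. E x (e i) \<and> P e x)"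
proof -
  obtain \<psi> where "b \<longrightarrow> db_bounded \<psi>" "set_db \<psi> \<subseteq> A"
    "\<forall>e. dsat E UNIV e \<psi> \<longleftrightarrow> P (\<lambda>n. e (Suc n)) (e 0)"
    using assms unfolding definable_def by blast
  then show ?thesis unfolding definable_def by (intro exI[of _ "DBEx (Var i) \<psi>"]) simp
qed

lemma definable_ball:
  assumes "definable E b A (\<lambda>e. P (\<lambda>n. e (Suc n)) (e 0))"
  shows "definable E b A (\<lambda>e. \<forall>x. E x (e i) \<longrightarrow> P e x)"
  using definable_not[OF definable_bex[OF definable_not[OF assms], of i]] by simp

lemma definable_ex:
  assumes "definable E False A (\<lambda>e. P (\<lambda>n. e (Suc n)) (e 0))"
  shows "definable E False A (\<lambda>e. \<exists>x. P e x)"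
proof -
  obtain \<psi> where "set_db \<psi> \<subseteq> A" "\<forall>e. dsat E UNIV e \<psi> \<longleftrightarrow> P (\<lambda>n. e (Suc n)) (e 0)"
    using assms unfolding definable_def by blast
  then show ?thesis unfolding definable_def by (intro exI[of _ "DEx \<psi>"]) simp
qed

lemma definable_all:
  assumes "definable E False A (\<lambda>e. P (\<lambda>n. e (Suc n)) (e 0))"
  shows "definable E False A (\<lambda>e. \<forall>x. P e x)"
  using definable_not[OF definable_ex[OF definable_not[OF assms]]] by simp

text \<open>The last two rules fit only \<open>b = False\<close>, so for \<open>b = True\<close> the
  same list also checks that every quantifier is bounded.\<close>

lemmas definable_rules =
  definable_mem definable_eq definable_not definable_and definable_or definable_imp definable_iff
  definable_bex definable_ball definable_ex definable_all

text \<open>Quantifiers over a world are bounded by that world, so truth in a set is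
  bounded-definable whatever the complexity of the formula. r says where in the environment each
  variable is found.\<close>

lemma definable_relativized:
  assumes "params \<phi> \<subseteq> A"
  shows "definable E b A (\<lambda>e. sat E (ext E (e i)) (\<lambda>n. e (r n)) \<phi>)"
  using assms
proof (induction \<phi> arbitrary: i r)
  case (FMem s t)
  have "dsat E UNIV e (DMem (sub_trm (\<lambda>n. Var (r n)) s) (sub_trm (\<lambda>n. Var (r n)) t)) \<longleftrightarrow>
      sat E (ext E (e i)) (\<lambda>n. e (r n)) (FMem s t)" for e
    by (simp add: val_sub_trm)
  moreover have "set_trm (sub_trm (\<lambda>n. Var (r n)) s) \<subseteq> A" "set_trm (sub_trm (\<lambda>n. Var (r n)) t) \<subseteq> A"
    using FMem by (simp_all add: set_sub_trm)
  ultimately show ?case unfolding definable_def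
    by (intro exI[of _ "DMem (sub_trm (\<lambda>n. Var (r n)) s) (sub_trm (\<lambda>n. Var (r n)) t)"]) simp
next
  case (FEq s t)
  have "dsat E UNIV e (DEq (sub_trm (\<lambda>n. Var (r n)) s) (sub_trm (\<lambda>n. Var (r n)) t)) \<longleftrightarrow>
      sat E (ext E (e i)) (\<lambda>n. e (r n)) (FEq s t)" for e
    by (simp add: val_sub_trm)
  moreover have "set_trm (sub_trm (\<lambda>n. Var (r n)) s) \<subseteq> A" "set_trm (sub_trm (\<lambda>n. Var (r n)) t) \<subseteq> A"
    using FEq by (simp_all add: set_sub_trm)
  ultimately show ?case unfolding definable_def
    by (intro exI[of _ "DEq (sub_trm (\<lambda>n. Var (r n)) s) (sub_trm (\<lambda>n. Var (r n)) t)"]) simp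
next
  case (FNeg \<phi>)
  then show ?case by (auto intro: definable_not)
next
  case (FAnd \<phi> \<psi>)
  then show ?case by (auto intro: definable_and)
next
  case (FEx m \<phi>)
  \<comment> \<open>Under the quantifier the variable m is read at the new index 0 and all others
    move up by one; this is why the induction is general in r.\<close>
  have eq: "(\<lambda>n. e (if n = m then 0 else Suc (r n))) = (\<lambda>n. e (Suc (r n)))(m := e 0)"
    for e :: "nat \<Rightarrow> 'a" by auto
  have "definable E b A (\<lambda>e. sat E (ext E (e (Suc i))) ((\<lambda>n. e (Suc (r n)))(m := e 0)) \<phi>)"
    using FEx.IH[of "Suc i" "\<lambda>n. if n = m then 0 else Suc (r n)"] FEx.prems unfolding eq by simp
  from definable_bex[where P = "\<lambda>e x. sat E (ext E (e i)) ((\<lambda>n. e (r n))(m := x)) \<phi>", OF this]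
  show ?case by (simp add: ext_def Bex_def)
next
  case (FAll m \<phi>)
  have eq: "(\<lambda>n. e (if n = m then 0 else Suc (r n))) = (\<lambda>n. e (Suc (r n)))(m := e 0)"
    for e :: "nat \<Rightarrow> 'a" by auto
  have "definable E b A (\<lambda>e. sat E (ext E (e (Suc i))) ((\<lambda>n. e (Suc (r n)))(m := e 0)) \<phi>)"
    using FAll.IH[of "Suc i" "\<lambda>n. if n = m then 0 else Suc (r n)"] FAll.prems unfolding eq by simp
  from definable_ball[where P = "\<lambda>e x. sat E (ext E (e i)) ((\<lambda>n. e (r n))(m := x)) \<phi>", OF this]
  show ?case by (simp add: ext_def Ball_def)
qed

section \<open>Definability by prenex formulas and induction over quantifier prefixes\<close>

definition Pi1_definable :: "('a \<Rightarrow> 'a \<Rightarrow> bool) \<Rightarrow> 'a set \<Rightarrow> ((nat \<Rightarrow> 'a) \<Rightarrow> bool) \<Rightarrow> bool" where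
  "Pi1_definable E A P \<longleftrightarrow>
    (\<exists>\<psi>. db_Pi1 \<psi> \<and> set_db \<psi> \<subseteq> A \<and> (\<forall>e. dsat E UNIV e \<psi> \<longleftrightarrow> P e))"

definition Sigma2_definable :: "('a \<Rightarrow> 'a \<Rightarrow> bool) \<Rightarrow> 'a set \<Rightarrow> ((nat \<Rightarrow> 'a) \<Rightarrow> bool) \<Rightarrow> bool" where
  "Sigma2_definable E A P \<longleftrightarrow>
    (\<exists>\<psi>. db_Sigma2 \<psi> \<and> set_db \<psi> \<subseteq> A \<and> (\<forall>e. dsat E UNIV e \<psi> \<longleftrightarrow> P e))"

lemma db_bounded_Pi1: "db_bounded \<psi> \<Longrightarrow> db_Pi1 \<psi>"
  by (cases \<psi>) auto

lemma db_Pi1_Sigma2: "db_Pi1 \<psi> \<Longrightarrow> db_Sigma2 \<psi>"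
  by (cases \<psi>) auto

lemma Pi1_definable_bounded: "definable E True A P \<Longrightarrow> Pi1_definable E A P"
  unfolding definable_def Pi1_definable_def using db_bounded_Pi1 by blast

lemma Sigma2_definable_Pi1: "Pi1_definable E A P \<Longrightarrow> Sigma2_definable E A P"
  unfolding Sigma2_definable_def Pi1_definable_def using db_Pi1_Sigma2 by blast

lemma Pi1_definable_all:
  assumes "Pi1_definable E A (\<lambda>e. P (\<lambda>n. e (Suc n)) (e 0))"
  shows "Pi1_definable E A (\<lambda>e. \<forall>x. P e x)"
proof -
  obtain \<psi> where "db_Pi1 \<psi>" "set_db \<psi> \<subseteq> A" "\<forall>e. dsat E UNIV e \<psi> \<longleftrightarrow> P (\<lambda>n. e (Suc n)) (e 0)"
    using assms unfolding Pi1_definable_def by blast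
  then show ?thesis unfolding Pi1_definable_def by (intro exI[of _ "DAll \<psi>"]) simp
qed

lemma Sigma2_definable_ex:
  assumes "Sigma2_definable E A (\<lambda>e. P (\<lambda>n. e (Suc n)) (e 0))"
  shows "Sigma2_definable E A (\<lambda>e. \<exists>x. P e x)"
proof -
  obtain \<psi> where "db_Sigma2 \<psi>" "set_db \<psi> \<subseteq> A" "\<forall>e. dsat E UNIV e \<psi> \<longleftrightarrow> P (\<lambda>n. e (Suc n)) (e 0)"
    using assms unfolding Sigma2_definable_def by blast
  then show ?thesis unfolding Sigma2_definable_def by (intro exI[of _ "DEx \<psi>"]) simp
qed

lemma Sigma_fm_0: "Sigma_fm 0 \<phi> \<Longrightarrow> Delta0_fm \<phi>"
  by (erule Sigma_fm.cases) auto

text \<open>One level of the mutual definition, unfolded: removing leading universal quantifiers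
  ends at level 0, that is, at a bounded formula.\<close>

lemma Pi1_induct [consumes 1, case_names Delta0 All]:
  assumes "Pi_fm (Suc 0) \<phi>" and "\<And>\<phi>. Delta0_fm \<phi> \<Longrightarrow> P \<phi>" and "\<And>k \<phi>. P \<phi> \<Longrightarrow> P (FAll k \<phi>)"
  shows "P \<phi>"
  using assms(1) by (induction \<phi> rule: fm.induct) (erule Pi_fm.cases; auto intro: assms(2,3) dest: Sigma_fm_0)+

lemma Sigma2_induct [consumes 1, case_names Pi1 Ex]:
  assumes "Sigma_fm 2 \<phi>" and "\<And>\<phi>. Pi_fm (Suc 0) \<phi> \<Longrightarrow> P \<phi>" and "\<And>k \<phi>. P \<phi> \<Longrightarrow> P (FEx k \<phi>)"
  shows "P \<phi>"
  using assms(1)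
  by (induction \<phi> rule: fm.induct) (erule Sigma_fm.cases; auto intro: assms(2,3) simp: numeral_2_eq_2)+

lemma ValD: "p \<in> Val E M L \<Longrightarrow> range \<sigma> \<subseteq> L \<Longrightarrow> true_at E M (map_modal \<sigma> p)"
  unfolding Val_def by blast

text \<open>Together with the next lemma it exchanges quantifiers over worlds for quantifiers over
  the valuations that they realise.\<close>

lemma ball_image_Collect: "T = f ` {x. P x} \<Longrightarrow> (\<forall>t\<in>T. Q t) \<longleftrightarrow> (\<forall>x. P x \<longrightarrow> Q (f x))"
  by auto

lemma bex_image_Collect: "T = f ` {x. P x} \<Longrightarrow> (\<exists>t\<in>T. Q t) \<longleftrightarrow> (\<exists>x. P x \<and> Q (f x))"
  by auto

section \<open>Set theory in a model of ZFC\<close>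

context ZFC
begin

lemma set_eqI: "(\<And>z. E z x \<longleftrightarrow> E z y) \<Longrightarrow> x = y"
  using extensionality by blast

lemma separate:
  assumes "definable E b A (\<lambda>e. Q (e 0) (e 1) (e 2) (e 3) (e 4))"
  shows "\<exists>s. \<forall>x. E x s \<longleftrightarrow> E x a \<and> Q x c1 c2 c3 c4"
proof -
  obtain \<psi> where \<psi>: "\<And>e. dsat E UNIV e \<psi> \<longleftrightarrow> Q (e 0) (e 1) (e 2) (e 3) (e 4)"
    using assms unfolding definable_def by blast
  \<comment> \<open>Index 0 stays the variable that Separation interprets; the other indices become
    parameters, and everything from 4 on is c4.\<close>
  define s where "s = (\<lambda>i :: nat. if i = 0 then Var 0 else Par (if i = 1 then c1 else if i = 2 then c2
    else if i = 3 then c3 else c4))"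
  have "fresh_from 1 s" by (simp add: fresh_from_def s_def)
  then have "sat E UNIV (e(0 := x)) (to_fm 1 s \<psi>) \<longleftrightarrow> Q x c1 c2 c3 c4" for e x
    by (simp add: sat_to_fm \<psi>) (simp add: s_def)
  then show ?thesis using separation[rule_format, of a undefined "to_fm 1 s \<psi>"] by simp
qed

lemma replace:
  assumes "definable E b A (\<lambda>e. R (e 0) (e 1) (e 2) (e 3))"
    and "\<And>x y z. E x a \<Longrightarrow> R x y c1 c2 \<Longrightarrow> R x z c1 c2 \<Longrightarrow> y = z"
  shows "\<exists>s. \<forall>y. E y s \<longleftrightarrow> (\<exists>x. E x a \<and> R x y c1 c2)"
proof -
  obtain \<psi> where \<psi>: "\<And>e. dsat E UNIV e \<psi> \<longleftrightarrow> R (e 0) (e 1) (e 2) (e 3)"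
    using assms(1) unfolding definable_def by blast
  define s where "s = (\<lambda>i :: nat. if i < 2 then Var i else Par (if i = 2 then c1 else c2))"
  have "fresh_from 2 s" by (simp add: fresh_from_def s_def)
  then have *: "sat E UNIV (e(0 := x, 1 := y)) (to_fm 2 s \<psi>) \<longleftrightarrow> R x y c1 c2" for e x y
    by (simp add: sat_to_fm \<psi>) (simp add: s_def)
  show ?thesis
    using replacement[rule_format, of a undefined "to_fm 2 s \<psi>"] assms(2) unfolding * by blast
qed

lemma ex_minimal: "E x A \<Longrightarrow> \<exists>y. E y A \<and> (\<forall>z. E z A \<longrightarrow> \<not> E z y)"
  using foundation by blast

text \<open>Separation forms the set of counterexamples in t, and Foundation gives a minimal one. As
  t must be a set, an induction that is to reach \<open>\<alpha>\<close> itself takes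
  \<open>t = scs \<alpha>\<close>.\<close>

lemma set_induct:
  assumes "definable E b A (\<lambda>e. Q (e 0) (e 1) (e 2) (e 3) (e 4))"
    and step: "\<And>x. E x t \<Longrightarrow> (\<And>y. E y x \<Longrightarrow> E y t \<Longrightarrow> Q y c1 c2 c3 c4) \<Longrightarrow> Q x c1 c2 c3 c4"
    and "E x t"
  shows "Q x c1 c2 c3 c4"
proof (rule ccontr)
  assume x: "\<not> Q x c1 c2 c3 c4"
  obtain B where B: "\<And>x. E x B \<longleftrightarrow> E x t \<and> \<not> Q x c1 c2 c3 c4"
    using separate[OF definable_not[OF assms(1)]] by blast
  from x \<open>E x t\<close> have "E x B" by (simp add: B)
  then obtain y where "E y B" "\<forall>z. E z B \<longrightarrow> \<not> E z y" using ex_minimal by blast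
  then show False using step B by blast
qed

section \<open>Pairs, successors and ordinals\<close>

definition upr :: "'a \<Rightarrow> 'a \<Rightarrow> 'a" where
  "upr x y = (THE z. \<forall>w. E w z \<longleftrightarrow> w = x \<or> w = y)"

lemma mem_upr: "E w (upr x y) \<longleftrightarrow> w = x \<or> w = y"
proof -
  have "\<exists>!z. \<forall>w. E w z \<longleftrightarrow> w = x \<or> w = y"
    using pairing[rule_format, of x y] by (auto intro!: set_eqI)
  from theI'[OF this] show ?thesis unfolding upr_def by blast
qed

lemma is_upair_iff: "is_upair E x y z \<longleftrightarrow> z = upr x y"
  unfolding is_upair_def by (auto simp: mem_upr intro: set_eqI)

lemma upr_eq: "upr x y = upr x' y' \<longleftrightarrow> x = x' \<and> y = y' \<or> x = y' \<and> y = x'"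
proof
  assume "upr x y = upr x' y'"
  then have "w = x \<or> w = y \<longleftrightarrow> w = x' \<or> w = y'" for w using mem_upr by metis
  then show "x = x' \<and> y = y' \<or> x = y' \<and> y = x'" by metis
qed (auto intro: set_eqI simp: mem_upr)

definition pr :: "'a \<Rightarrow> 'a \<Rightarrow> 'a" where
  "pr x y = upr (upr x x) (upr x y)"

lemma pr_eq: "pr x y = pr x' y' \<longleftrightarrow> x = x' \<and> y = y'"
  unfolding pr_def upr_eq by blast

lemma is_opair_iff: "is_opair E x y p \<longleftrightarrow> p = pr x y"
  unfolding is_opair_def is_upair_iff pr_def by blast

lemma maps_to_iff: "maps_to E f x y \<longleftrightarrow> E (pr x y) f"
  unfolding maps_to_def is_opair_iff by blast

definition un :: "'a \<Rightarrow> 'a \<Rightarrow> 'a" where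
  "un a b = (THE u. \<forall>z. E z u \<longleftrightarrow> E z a \<or> E z b)"

lemma mem_un: "E z (un a b) \<longleftrightarrow> E z a \<or> E z b"
proof -
  obtain u where "\<forall>z. E z u \<longleftrightarrow> (\<exists>y. E y (upr a b) \<and> E z y)"
    using union by blast
  then have "\<forall>z. E z u \<longleftrightarrow> E z a \<or> E z b" by (auto simp: mem_upr)
  then have "\<exists>!u. \<forall>z. E z u \<longleftrightarrow> E z a \<or> E z b" by (auto intro!: set_eqI)
  from theI'[OF this] show ?thesis unfolding un_def by blast
qed

definition scs :: "'a \<Rightarrow> 'a" where
  "scs x = un x (upr x x)"

lemma mem_scs: "E z (scs x) \<longleftrightarrow> E z x \<or> z = x"
  by (simp add: scs_def mem_un mem_upr)

lemma is_succ_iff: "is_succ E x s \<longleftrightarrow> s = scs x"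
  unfolding is_succ_def by (auto simp: mem_scs intro: set_eqI)

lemma not_mem_self: "\<not> E x x"
proof
  assume "E x x"
  obtain y where "E y (upr x x)" "\<forall>z. E z (upr x x) \<longrightarrow> \<not> E z y"
    using ex_minimal[of x "upr x x"] by (auto simp: mem_upr)
  then show False using \<open>E x x\<close> by (auto simp: mem_upr)
qed

lemma mem_asym: "E x y \<Longrightarrow> \<not> E y x"
proof
  assume "E x y" "E y x"
  obtain z where "E z (upr x y)" "\<forall>w. E w (upr x y) \<longrightarrow> \<not> E w z"
    using ex_minimal[of x "upr x y"] by (auto simp: mem_upr)
  then show False using \<open>E x y\<close> \<open>E y x\<close> by (auto simp: mem_upr)
qed

lemma ordinal_mem: "is_ordinal E \<alpha> \<Longrightarrow> E \<beta> \<alpha> \<Longrightarrow> is_ordinal E \<beta>"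
  unfolding is_ordinal_def trans_set_def subset_def by blast

lemma ordinal_trans: "is_ordinal E \<alpha> \<Longrightarrow> E \<beta> \<alpha> \<Longrightarrow> E \<gamma> \<beta> \<Longrightarrow> E \<gamma> \<alpha>"
  unfolding is_ordinal_def trans_set_def subset_def by blast

lemma ordinal_scs: "is_ordinal E \<alpha> \<Longrightarrow> is_ordinal E (scs \<alpha>)"
  unfolding is_ordinal_def trans_set_def subset_def mem_scs by blast

text \<open>The definition quantifies over all sets; the form bounded by z makes pairs and functions
  available in bounded matrices.\<close>

lemma definable_upair: "definable E b A (\<lambda>e. is_upair E (e i) (e j) (e k))"
proof -
  have *: "is_upair E x y z \<longleftrightarrow> E x z \<and> E y z \<and> (\<forall>w. E w z \<longrightarrow> w = x \<or> w = y)" for x y z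
    unfolding is_upair_def by blast
  show ?thesis unfolding * by (intro definable_rules)
qed

lemma definable_opair: "definable E b A (\<lambda>e. is_opair E (e i) (e j) (e k))"
proof -
  have *: "is_opair E x y p \<longleftrightarrow> (\<exists>a. E a p \<and> (\<exists>b. E b p \<and>
      is_upair E x x a \<and> is_upair E x y b \<and> is_upair E a b p))" for x y p
    unfolding is_opair_def is_upair_iff by (auto simp: mem_upr)
  show ?thesis unfolding * by (intro definable_rules definable_upair)
qed

lemma definable_maps_to: "definable E b A (\<lambda>e. maps_to E (e i) (e j) (e k))"
  unfolding maps_to_def by (intro definable_rules definable_opair)

lemma definable_subset: "definable E b A (\<lambda>e. subset E (e i) (e j))"
  unfolding subset_def by (intro definable_rules)

lemma definable_trans_set: "definable E b A (\<lambda>e. trans_set E (e i))"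
  unfolding trans_set_def by (intro definable_rules definable_subset)

lemma definable_ordinal: "definable E b A (\<lambda>e. is_ordinal E (e i))"
  unfolding is_ordinal_def by (intro definable_rules definable_trans_set)

lemmas definable_sets =
  definable_opair definable_maps_to definable_subset definable_trans_set definable_ordinal

text \<open>Double induction on membership. In a minimal incomparable pair each member of one is
  comparable to the other, and can only be a member of it, since otherwise transitivity would
  compare the pair; so both have the same elements.\<close>

lemma ordinal_linear:
  assumes "is_ordinal E \<alpha>" and "is_ordinal E \<beta>"
  shows "E \<alpha> \<beta> \<or> \<alpha> = \<beta> \<or> E \<beta> \<alpha>"
proof -
  define C where "C x y \<longleftrightarrow> E x y \<or> x = y \<or> E y x" for x y
  have *: "\<forall>y. is_ordinal E y \<longrightarrow> C x y" if "E x (scs \<alpha>)" for x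
  proof (rule set_induct[where Q = "\<lambda>x _ _ _ _. \<forall>y. is_ordinal E y \<longrightarrow> C x y", OF _ _ that])
    show "definable E False {} (\<lambda>e. \<forall>y. is_ordinal E y \<longrightarrow> C (e 0) y)"
      unfolding C_def by (intro definable_rules definable_sets)
  next
    fix x assume x: "E x (scs \<alpha>)"
      and IH1: "\<And>z. E z x \<Longrightarrow> E z (scs \<alpha>) \<Longrightarrow> \<forall>y. is_ordinal E y \<longrightarrow> C z y"
    have ox: "is_ordinal E x" using x assms ordinal_mem ordinal_scs by blast
    have IH: "C z y" if "E z x" "is_ordinal E y" for z y
      using IH1[OF that(1)] that ordinal_trans[OF ordinal_scs[OF assms(1)] x that(1)] by blast
    have "C x y" if y: "is_ordinal E y" for y
    proof (rule set_induct[where Q = "\<lambda>y x _ _ _. C x y" and ?c1.0 = x and t = "scs y"])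
      show "definable E False {} (\<lambda>e. C (e 1) (e 0))"
        unfolding C_def by (intro definable_rules)
      show "E y (scs y)" by (simp add: mem_scs)
      fix y' assume y': "E y' (scs y)" and IH2: "\<And>z. E z y' \<Longrightarrow> E z (scs y) \<Longrightarrow> C x z"
      have oy: "is_ordinal E y'" using y' y ordinal_mem ordinal_scs by blast
      have IH2: "C x z" if "E z y'" for z
        using IH2[OF that] ordinal_trans[OF ordinal_scs[OF y] y' that] by blast
      show "C x y'"
      proof (rule ccontr)
        assume n: "\<not> C x y'"
        have "E z y'" if "E z x" for z
          using IH[OF that oy] n that ordinal_trans[OF ox that] unfolding C_def by blast
        moreover have "E z x" if "E z y'" for z
          using IH2[OF that] n that ordinal_trans[OF oy that] unfolding C_def by blast
        ultimately have "x = y'" by (intro set_eqI) blast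
        then show False using n unfolding C_def by blast
      qed
    qed
    then show "\<forall>y. is_ordinal E y \<longrightarrow> C x y" by blast
  qed
  then show ?thesis using assms unfolding C_def by (simp add: mem_scs)
qed

subsection \<open>Recursion along ordinals\<close>

text \<open>A partial solution of the recursion on any transitive set s of ordinals. That f has a
  single value at each point of s follows from \<open>level_unique\<close>.\<close>

definition attempt :: "('a \<Rightarrow> 'a \<Rightarrow> bool) \<Rightarrow> 'a \<Rightarrow> 'a \<Rightarrow> bool" where
  "attempt S f s \<longleftrightarrow> trans_set E s \<and>
    (\<forall>\<beta>. E \<beta> s \<longrightarrow> is_ordinal E \<beta> \<and> (\<exists>u. maps_to E f \<beta> u)) \<and>
    (\<forall>\<beta> u. E \<beta> s \<and> maps_to E f \<beta> u \<longrightarrow>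
      (\<forall>x. E x u \<longleftrightarrow> (\<exists>\<gamma> w. E \<gamma> \<beta> \<and> maps_to E f \<gamma> w \<and> S x w)))"

text \<open>\<open>v\<close> is the value at \<open>\<alpha>\<close> of the recursion \<open>H\<^sub>\<alpha> = {x. \<exists>\<gamma> < \<alpha>. S x H\<^sub>\<gamma>}\<close>.\<close>

definition level :: "('a \<Rightarrow> 'a \<Rightarrow> bool) \<Rightarrow> 'a \<Rightarrow> 'a \<Rightarrow> bool" where
  "level S \<alpha> v \<longleftrightarrow> (\<exists>f s. attempt S f s \<and> E \<alpha> s \<and> maps_to E f \<alpha> v)"

lemma attempt_trans: "attempt S f s \<Longrightarrow> E \<beta> s \<Longrightarrow> E \<gamma> \<beta> \<Longrightarrow> E \<gamma> s"
  unfolding attempt_def trans_set_def subset_def by blast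

lemma attempt_total: "attempt S f s \<Longrightarrow> E \<beta> s \<Longrightarrow> \<exists>u. maps_to E f \<beta> u"
  unfolding attempt_def by simp

lemma attempt_step:
  "attempt S f s \<Longrightarrow> E \<beta> s \<Longrightarrow> maps_to E f \<beta> u \<Longrightarrow>
    E x u \<longleftrightarrow> (\<exists>\<gamma> w. E \<gamma> \<beta> \<and> maps_to E f \<gamma> w \<and> S x w)"
  unfolding attempt_def by simp

lemma level_unique:
  assumes "level S \<alpha> v" and "level S \<alpha> v'"
  shows "v = v'"
proof -
  obtain f s where f: "attempt S f s" "E \<alpha> s" "maps_to E f \<alpha> v"
    using assms(1) unfolding level_def by blast
  obtain f' s' where f': "attempt S f' s'" "E \<alpha> s'" "maps_to E f' \<alpha> v'"
    using assms(2) unfolding level_def by blast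
  define Q where "Q = (\<lambda>\<beta> f f' s'. E \<beta> s' \<longrightarrow>
    (\<forall>u u'. maps_to E f \<beta> u \<and> maps_to E f' \<beta> u' \<longrightarrow> u = u'))"
  have "Q \<alpha> f f' s'"
  proof (rule set_induct[where Q = "\<lambda>\<beta> f f' s' _. Q \<beta> f f' s'", OF _ _ f(2)])
    show "definable E False {} (\<lambda>e. Q (e 0) (e 1) (e 2) (e 3))"
      unfolding Q_def by (intro definable_rules definable_sets)
  next
    fix \<beta> assume \<beta>: "E \<beta> s" and IH: "\<And>\<gamma>. E \<gamma> \<beta> \<Longrightarrow> E \<gamma> s \<Longrightarrow> Q \<gamma> f f' s'"
    show "Q \<beta> f f' s'" unfolding Q_def
    proof (intro impI allI)
      fix u u' assume \<beta>': "E \<beta> s'" and u: "maps_to E f \<beta> u \<and> maps_to E f' \<beta> u'"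
      have s: "E \<gamma> s" "E \<gamma> s'" if "E \<gamma> \<beta>" for \<gamma>
        using attempt_trans[OF f(1) \<beta> that] attempt_trans[OF f'(1) \<beta>' that] by blast+
      have eq: "w = w'" if "E \<gamma> \<beta>" "maps_to E f \<gamma> w" "maps_to E f' \<gamma> w'" for \<gamma> w w'
        using IH[OF that(1) s(1)[OF that(1)]] s(2)[OF that(1)] that unfolding Q_def by blast
      have ex: "(\<exists>w. maps_to E f \<gamma> w) \<and> (\<exists>w. maps_to E f' \<gamma> w)" if "E \<gamma> \<beta>" for \<gamma>
        using attempt_total[OF f(1)] attempt_total[OF f'(1)] s[OF that] by blast
      show "u = u'"
      proof (rule set_eqI)
        fix x
        have "E x u \<longleftrightarrow> (\<exists>\<gamma> w. E \<gamma> \<beta> \<and> maps_to E f \<gamma> w \<and> S x w)"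
          using attempt_step[OF f(1) \<beta>] u by blast
        also have "\<dots> \<longleftrightarrow> (\<exists>\<gamma> w. E \<gamma> \<beta> \<and> maps_to E f' \<gamma> w \<and> S x w)"
        proof
          assume "\<exists>\<gamma> w. E \<gamma> \<beta> \<and> maps_to E f \<gamma> w \<and> S x w"
          then obtain \<gamma> w where w: "E \<gamma> \<beta>" "maps_to E f \<gamma> w" "S x w" by blast
          then obtain w' where "maps_to E f' \<gamma> w'" using ex by blast
          with w eq[of \<gamma> w w'] show "\<exists>\<gamma> w. E \<gamma> \<beta> \<and> maps_to E f' \<gamma> w \<and> S x w" by blast
        next
          assume "\<exists>\<gamma> w. E \<gamma> \<beta> \<and> maps_to E f' \<gamma> w \<and> S x w"
          then obtain \<gamma> w where w: "E \<gamma> \<beta>" "maps_to E f' \<gamma> w" "S x w" by blast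
          then obtain w' where "maps_to E f \<gamma> w'" using ex by blast
          with w eq[of \<gamma> w' w] show "\<exists>\<gamma> w. E \<gamma> \<beta> \<and> maps_to E f \<gamma> w \<and> S x w" by blast
        qed
        also have "\<dots> \<longleftrightarrow> E x u'"
          using attempt_step[OF f'(1) \<beta>'] u by blast
        finally show "E x u \<longleftrightarrow> E x u'" .
      qed
    qed
  qed
  then show ?thesis using f(3) f'(2,3) unfolding Q_def by blast
qed

text \<open>Below \<open>\<alpha>\<close> an attempt takes exactly the values given by
  \<open>level\<close>, so its recursion equation becomes one that no longer mentions it.\<close>

lemma level_iff:
  assumes "level S \<alpha> v"
  shows "E x v \<longleftrightarrow> (\<exists>\<gamma> w. E \<gamma> \<alpha> \<and> level S \<gamma> w \<and> S x w)"
proof -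
  obtain f s where f: "attempt S f s" "E \<alpha> s" "maps_to E f \<alpha> v"
    using assms(1) unfolding level_def by blast
  have "maps_to E f \<gamma> w \<longleftrightarrow> level S \<gamma> w" if "E \<gamma> \<alpha>" for \<gamma> w
  proof -
    have \<gamma>: "E \<gamma> s" by (rule attempt_trans[OF f(1,2) that])
    then obtain w' where w': "maps_to E f \<gamma> w'" using attempt_total[OF f(1)] by blast
    have "level S \<gamma> w" if "maps_to E f \<gamma> w" for w
      using f(1) \<gamma> that unfolding level_def by blast
    then show ?thesis using level_unique w' by metis
  qed
  moreover have "E x v \<longleftrightarrow> (\<exists>\<gamma> w. E \<gamma> \<alpha> \<and> maps_to E f \<gamma> w \<and> S x w)"
    by (rule attempt_step[OF f])
  ultimately show ?thesis by blast
qed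

lemma level_ordinal: "level S \<alpha> v \<Longrightarrow> is_ordinal E \<alpha>"
  unfolding level_def attempt_def by blast

text \<open>The extra argument of S is a set parameter: the hierarchy above a given set c is built
  with it, while the cumulative hierarchy ignores it.\<close>

context
  fixes S :: "'a \<Rightarrow> 'a \<Rightarrow> 'a \<Rightarrow> bool"
  assumes definable_step: "\<And>i j k. definable E False {} (\<lambda>e. S (e i) (e j) (e k))"
    and step_set: "\<And>c w. \<exists>s. \<forall>x. E x s \<longleftrightarrow> S c x w"
begin

lemma definable_level: "definable E False {} (\<lambda>e. level (S (e i)) (e j) (e k))"
  unfolding level_def attempt_def by (intro definable_rules definable_sets definable_step)

text \<open>Replacement collects the values below \<open>\<alpha>\<close> into one function, to
  which the value at \<open>\<alpha>\<close> is added. The domain is exactly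
  \<open>scs \<alpha>\<close> because \<open>is_V\<close> asks for such a witness.\<close>

lemma level_extend:
  assumes \<alpha>: "is_ordinal E \<alpha>" and below: "\<And>\<gamma>. E \<gamma> \<alpha> \<Longrightarrow> \<exists>v. level (S c) \<gamma> v"
  shows "\<exists>f v. is_function E f (scs \<alpha>) \<and> attempt (S c) f (scs \<alpha>) \<and> maps_to E f \<alpha> v"
proof -
  define R where "R = (\<lambda>\<gamma> p c. \<exists>v. level (S c) \<gamma> v \<and> is_opair E \<gamma> v p)"
  have "\<exists>F. \<forall>p. E p F \<longleftrightarrow> (\<exists>\<gamma>. E \<gamma> \<alpha> \<and> R \<gamma> p c)"
  proof (rule replace[where R = "\<lambda>\<gamma> p c _. R \<gamma> p c"])
    show "definable E False {} (\<lambda>e. R (e 0) (e 1) (e 2))"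
      unfolding R_def by (intro definable_rules definable_sets definable_level)
    show "p = q" if "R \<gamma> p c" "R \<gamma> q c" for \<gamma> p q
      using that level_unique unfolding R_def is_opair_iff by metis
  qed
  then obtain F where F: "\<And>p. E p F \<longleftrightarrow> (\<exists>\<gamma>. E \<gamma> \<alpha> \<and> R \<gamma> p c)" by blast
  \<comment> \<open>The new value is a union of the sets \<open>{x. S c x v}\<close>, one for each
    \<open>\<gamma>\<close> below \<open>\<alpha>\<close>; Replacement makes a set of them.\<close>
  define R' where "R' = (\<lambda>\<gamma> y c. \<exists>v. level (S c) \<gamma> v \<and> (\<forall>x. E x y \<longleftrightarrow> S c x v))"
  have "\<exists>G. \<forall>y. E y G \<longleftrightarrow> (\<exists>\<gamma>. E \<gamma> \<alpha> \<and> R' \<gamma> y c)"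
  proof (rule replace[where R = "\<lambda>\<gamma> p c _. R' \<gamma> p c"])
    show "definable E False {} (\<lambda>e. R' (e 0) (e 1) (e 2))"
      unfolding R'_def by (intro definable_rules definable_sets definable_level definable_step)
    show "y = z" if R': "R' \<gamma> y c" "R' \<gamma> z c" for \<gamma> y z
    proof -
      obtain v where "level (S c) \<gamma> v" "\<forall>x. E x y \<longleftrightarrow> S c x v" using R'(1) unfolding R'_def by blast
      moreover obtain v' where "level (S c) \<gamma> v'" "\<forall>x. E x z \<longleftrightarrow> S c x v'" using R'(2) unfolding R'_def by blast
      ultimately show ?thesis using level_unique[of "S c" \<gamma> v v'] by (intro set_eqI) simp
    qed
  qed
  then obtain G where G: "\<And>y. E y G \<longleftrightarrow> (\<exists>\<gamma>. E \<gamma> \<alpha> \<and> R' \<gamma> y c)" by blast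
  obtain v0 where "\<forall>z. E z v0 \<longleftrightarrow> (\<exists>y. E y G \<and> E z y)" using union by blast
  then have v0': "E z v0 \<longleftrightarrow> (\<exists>y \<gamma>. E \<gamma> \<alpha> \<and> R' \<gamma> y c \<and> E z y)" for z
    unfolding G by blast
  have v0: "E z v0 \<longleftrightarrow> (\<exists>\<gamma> v. E \<gamma> \<alpha> \<and> level (S c) \<gamma> v \<and> S c z v)" for z
  proof
    show "E z v0 \<Longrightarrow> \<exists>\<gamma> v. E \<gamma> \<alpha> \<and> level (S c) \<gamma> v \<and> S c z v"
      unfolding v0' R'_def by blast
    assume "\<exists>\<gamma> v. E \<gamma> \<alpha> \<and> level (S c) \<gamma> v \<and> S c z v"
    then obtain \<gamma> v where v: "E \<gamma> \<alpha>" "level (S c) \<gamma> v" "S c z v" by blast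
    obtain y where "\<forall>x. E x y \<longleftrightarrow> S c x v" using step_set by blast
    with v show "E z v0" unfolding v0' R'_def by blast
  qed
  define f where "f = un F (upr (pr \<alpha> v0) (pr \<alpha> v0))"
  have f: "maps_to E f \<gamma> w \<longleftrightarrow> E \<gamma> \<alpha> \<and> level (S c) \<gamma> w \<or> \<gamma> = \<alpha> \<and> w = v0" for \<gamma> w
    unfolding maps_to_iff f_def mem_un mem_upr F R_def is_opair_iff pr_eq by blast
  have fun_f: "\<exists>x y. E x (scs \<alpha>) \<and> p = pr x y" if "E p f" for p
    using that unfolding f_def mem_un mem_upr F R_def is_opair_iff mem_scs by blast
  have ex: "\<exists>!w. maps_to E f \<gamma> w" if "E \<gamma> (scs \<alpha>)" for \<gamma>
  proof (cases "\<gamma> = \<alpha>")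
    case True
    then show ?thesis unfolding f using not_mem_self[of \<alpha>] by auto
  next
    case False
    then have "E \<gamma> \<alpha>" using that by (simp add: mem_scs)
    then obtain w where w: "level (S c) \<gamma> w" using below by blast
    then have "w' = w" if "level (S c) \<gamma> w'" for w' using that level_unique by blast
    then show ?thesis unfolding f using False w \<open>E \<gamma> \<alpha>\<close> by auto
  qed
  have "E x u \<longleftrightarrow> (\<exists>\<gamma> w. E \<gamma> \<beta> \<and> maps_to E f \<gamma> w \<and> S c x w)"
    if "E \<beta> (scs \<alpha>)" "maps_to E f \<beta> u" for \<beta> u x
  proof (cases "\<beta> = \<alpha>")
    case True
    then have "u = v0" using that not_mem_self[of \<alpha>] unfolding f by blast
    then show ?thesis using True not_mem_self[of \<alpha>] v0[of x] unfolding f by blast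
  next
    case False
    then have \<beta>: "E \<beta> \<alpha>" "level (S c) \<beta> u" using that unfolding f by blast+
    then show ?thesis
      using level_iff[OF \<beta>(2), of x] ordinal_trans[OF \<alpha> \<beta>(1)] mem_asym[OF \<beta>(1)] unfolding f by blast
  qed
  moreover have "is_ordinal E (scs \<alpha>)" using \<alpha> by (rule ordinal_scs)
  ultimately have "attempt (S c) f (scs \<alpha>)"
    unfolding attempt_def using ex1_implies_ex[OF ex] ordinal_mem[of "scs \<alpha>"]
    by (simp add: is_ordinal_def)
  moreover have "is_function E f (scs \<alpha>)"
    unfolding is_function_def is_opair_iff using fun_f ex by blast
  moreover have "maps_to E f \<alpha> v0" by (simp add: f)
  ultimately show ?thesis by blast
qed

lemma level_exists:
  assumes "is_ordinal E \<alpha>"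
  shows "\<exists>v. level (S c) \<alpha> v"
proof (rule set_induct[where Q = "\<lambda>\<alpha> c _ _ _. \<exists>v. level (S c) \<alpha> v" and t = "scs \<alpha>"])
  show "definable E False {} (\<lambda>e. \<exists>v. level (S (e 1)) (e 0) v)"
    by (intro definable_rules definable_level)
  show "E \<alpha> (scs \<alpha>)" by (simp add: mem_scs)
  fix \<beta> assume \<beta>: "E \<beta> (scs \<alpha>)"
    and IH: "\<And>\<gamma>. E \<gamma> \<beta> \<Longrightarrow> E \<gamma> (scs \<alpha>) \<Longrightarrow> \<exists>v. level (S c) \<gamma> v"
  have o: "is_ordinal E (scs \<alpha>)" by (rule ordinal_scs[OF assms])
  have "\<exists>f v. is_function E f (scs \<beta>) \<and> attempt (S c) f (scs \<beta>) \<and> maps_to E f \<beta> v"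
    by (rule level_extend[OF ordinal_mem[OF o \<beta>]]) (rule IH, assumption, rule ordinal_trans[OF o \<beta>])
  then show "\<exists>v. level (S c) \<beta> v" unfolding level_def using mem_scs by blast
qed

end

section \<open>Limit ordinals and transitive sets without maximal elements\<close>

text \<open>The inductive set of Infinity need not be transitive or consist of ordinals. Its
  ordinals that are also subsets of it do form an ordinal closed under successor.\<close>

lemma ex_limit_ordinal: "\<exists>l. is_ordinal E l \<and> (\<exists>z. E z l) \<and> (\<forall>x. E x l \<longrightarrow> E (scs x) l)"
proof -
  obtain w z where z: "E z w" "\<forall>x. \<not> E x z"
    and w: "\<forall>x. E x w \<longrightarrow> (\<exists>s. E s w \<and> (\<forall>z. E z s \<longleftrightarrow> E z x \<or> z = x))"
    using infinity by blast
  have w: "E (scs x) w" if x: "E x w" for x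
  proof -
    obtain s where s: "E s w" "is_succ E x s" using w x unfolding is_succ_def by blast
    then show ?thesis by (simp add: is_succ_iff)
  qed
  have "definable E False {} (\<lambda>e. is_ordinal E (e 0) \<and> subset E (e 0) (e 1))"
    by (intro definable_rules definable_sets)
  from separate[where Q = "\<lambda>n w _ _ _. is_ordinal E n \<and> subset E n w", OF this]
  obtain l where l: "\<And>n. E n l \<longleftrightarrow> E n w \<and> is_ordinal E n \<and> subset E n w" by blast
  have tr: "E m l" if "E n l" "E m n" for m n
  proof -
    have n: "is_ordinal E n" "subset E n w" using that(1) l by blast+
    then have "E m w" "is_ordinal E m" using that(2) ordinal_mem unfolding subset_def by blast+
    moreover have "subset E m w"
      using n ordinal_trans[OF n(1) that(2)] unfolding subset_def by blast
    ultimately show ?thesis by (simp add: l)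
  qed
  have "trans_set E l" using tr unfolding trans_set_def subset_def by blast
  moreover have "trans_set E n" if "E n l" for n using that l unfolding is_ordinal_def by blast
  ultimately have "is_ordinal E l" unfolding is_ordinal_def by blast
  moreover have "E z l" using z by (simp add: l is_ordinal_def trans_set_def subset_def)
  moreover have "E (scs x) l" if "E x l" for x
  proof -
    have x: "E x w" "is_ordinal E x" "subset E x w" using that l by blast+
    then have "subset E (scs x) w" by (simp add: subset_def mem_scs)
    with x show ?thesis by (simp add: l w ordinal_scs)
  qed
  ultimately show ?thesis by blast
qed

text \<open>Start from c and iterate up to a limit ordinal: taking members of members gives
  transitivity, and taking subsets supplies the singleton \<open>{y}\<close> above each y.\<close>

lemma ex_transitive_unbounded:
  "\<exists>T. trans_set E T \<and> subset E c T \<and> (\<forall>y. E y T \<longrightarrow> (\<exists>z. E z T \<and> E y z))"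
proof -
  define S where "S = (\<lambda>c y w. E y c \<or> subset E y w \<or> (\<exists>z. E z w \<and> E y z))"
  have def: "definable E False {} (\<lambda>e. S (e i) (e j) (e k))" for i j k
    unfolding S_def by (intro definable_rules definable_sets)
  have set: "\<exists>s. \<forall>x. E x s \<longleftrightarrow> S c x w" for c w
  proof -
    obtain u where "\<forall>z. E z u \<longleftrightarrow> (\<exists>y. E y w \<and> E z y)" using union by blast
    moreover obtain p where "\<forall>z. E z p \<longleftrightarrow> subset E z w" using power_set by blast
    ultimately have "E x (un c (un p u)) \<longleftrightarrow> S c x w" for x by (simp add: mem_un S_def)
    then show ?thesis by blast
  qed
  obtain l where l: "is_ordinal E l" "\<exists>z. E z l" "\<And>x. E x l \<Longrightarrow> E (scs x) l"
    using ex_limit_ordinal by blast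
  have ex: "\<exists>v. level (S c) \<alpha> v" if "is_ordinal E \<alpha>" for \<alpha>
    using level_exists[of S, OF def set that] .
  obtain T where T: "level (S c) l T" using ex[OF l(1)] by blast
  have in_T: "E y T" if "E \<gamma> l" "level (S c) \<gamma> w" "S c y w" for y \<gamma> w
    using that level_iff[OF T] by blast
  \<comment> \<open>An element of T arises from some stage \<open>\<gamma>\<close> and is a member
    of the stage \<open>scs \<gamma>\<close>, which is still below the limit.\<close>
  have stage: "\<exists>\<gamma> w. E \<gamma> l \<and> level (S c) \<gamma> w \<and> E y w" if y: "E y T" for y
  proof -
    obtain \<gamma> w where \<gamma>: "E \<gamma> l" "level (S c) \<gamma> w" "S c y w" using y level_iff[OF T] by blast
    obtain w' where w': "level (S c) (scs \<gamma>) w'" using ex[OF ordinal_mem[OF l(1) l(3)[OF \<gamma>(1)]]] by blast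
    have "E y w'" using \<gamma> level_iff[OF w'] mem_scs by blast
    then show ?thesis using l(3)[OF \<gamma>(1)] w' by blast
  qed
  have "trans_set E T" unfolding trans_set_def subset_def
  proof (intro allI impI)
    fix y z assume "E y T" "E z y"
    then obtain \<gamma> w where "E \<gamma> l" "level (S c) \<gamma> w" "E y w" using stage by blast
    moreover from \<open>E y w\<close> \<open>E z y\<close> have "S c z w" unfolding S_def by blast
    ultimately show "E z T" using in_T by blast
  qed
  moreover have "subset E c T" unfolding subset_def
  proof (intro allI impI)
    fix y assume y: "E y c"
    obtain \<gamma> where \<gamma>: "E \<gamma> l" using l(2) by blast
    obtain w where "level (S c) \<gamma> w" using ex[OF ordinal_mem[OF l(1) \<gamma>]] by blast
    then show "E y T" using in_T[OF \<gamma>] y unfolding S_def by blast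
  qed
  moreover have "\<exists>z. E z T \<and> E y z" if y: "E y T" for y
  proof -
    obtain \<gamma> w where w: "E \<gamma> l" "level (S c) \<gamma> w" "E y w" using stage[OF y] by blast
    then have "S c (upr y y) w" unfolding S_def subset_def by (simp add: mem_upr)
    then have "E (upr y y) T" using in_T w by blast
    then show ?thesis using mem_upr by blast
  qed
  ultimately show ?thesis by blast
qed

lemma ex_transitive: "\<exists>T. trans_set E T \<and> subset E c T \<and> E x T"
  using ex_transitive_unbounded[of "un c (upr x x)"] unfolding subset_def mem_un mem_upr by blast

subsection \<open>The cumulative hierarchy\<close>

lemma power_step: "\<exists>s. \<forall>x. E x s \<longleftrightarrow> subset E x w"
  using power_set by blast

text \<open>A witness for \<open>is_V\<close> is an attempt, but an attempt may have a larger domain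
  or extra pairs. The converse therefore constructs a witness afresh and appeals to uniqueness of
  the value.\<close>

lemma is_V_level: "is_V E \<alpha> v \<longleftrightarrow> level (subset E) \<alpha> v"
proof -
  have 1: "level (subset E) \<alpha> v" if V: "is_V E \<alpha> v" for v
  proof -
    obtain f where f: "is_ordinal E \<alpha>" "is_function E f (scs \<alpha>)" "maps_to E f \<alpha> v"
      "\<forall>\<beta> u. maps_to E f \<beta> u \<longrightarrow>
         (\<forall>x. E x u \<longleftrightarrow> (\<exists>\<gamma> w. E \<gamma> \<beta> \<and> maps_to E f \<gamma> w \<and> subset E x w))"
      using V unfolding is_V_def is_succ_iff by blast
    have o: "is_ordinal E (scs \<alpha>)" using f(1) by (rule ordinal_scs)
    have "\<exists>u. maps_to E f \<beta> u" if "E \<beta> (scs \<alpha>)" for \<beta>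
      using f(2) that unfolding is_function_def by blast
    then have "attempt (subset E) f (scs \<alpha>)"
      unfolding attempt_def using o f(4) ordinal_mem[OF o] unfolding is_ordinal_def by blast
    then show ?thesis unfolding level_def using f(3) mem_scs by blast
  qed
  have 2: "\<exists>v. is_V E \<alpha> v" if "is_ordinal E \<alpha>"
  proof -
    have "definable E False {} (\<lambda>e. subset E (e j) (e k))" for j k
      by (rule definable_subset)
    note S = this power_step
    have "\<exists>f v. is_function E f (scs \<alpha>) \<and> attempt (subset E) f (scs \<alpha>) \<and> maps_to E f \<alpha> v"
      by (rule level_extend[of "\<lambda>_. subset E", OF S that])
        (rule level_exists[of "\<lambda>_. subset E", OF S], rule ordinal_mem[OF that])
    then obtain f v where f: "is_function E f (scs \<alpha>)" "attempt (subset E) f (scs \<alpha>)" "maps_to E f \<alpha> v"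
      by blast
    have "E \<beta> (scs \<alpha>)" if "maps_to E f \<beta> u" for \<beta> u
    proof -
      have "E (pr \<beta> u) f" using that by (simp add: maps_to_iff)
      then obtain x y where "E x (scs \<alpha>)" "pr \<beta> u = pr x y"
        using f(1) unfolding is_function_def is_opair_iff by blast
      then show ?thesis by (simp add: pr_eq)
    qed
    then have "\<forall>\<beta> u. maps_to E f \<beta> u \<longrightarrow>
         (\<forall>x. E x u \<longleftrightarrow> (\<exists>\<gamma> w. E \<gamma> \<beta> \<and> maps_to E f \<gamma> w \<and> subset E x w))"
      using attempt_step[OF f(2)] by blast
    then show ?thesis unfolding is_V_def is_succ_iff using that f(1,3) by blast
  qed
  show ?thesis
  proof
    assume v: "level (subset E) \<alpha> v"
    then obtain v' where v': "is_V E \<alpha> v'" using 2[OF level_ordinal] by blast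
    with level_unique[OF v 1[OF v']] show "is_V E \<alpha> v" by simp
  qed (rule 1)
qed

lemma V_exists: "is_ordinal E \<alpha> \<Longrightarrow> \<exists>v. is_V E \<alpha> v"
  unfolding is_V_level by (rule level_exists[of "\<lambda>_. subset E", OF definable_subset power_step])

lemma V_unique: "is_V E \<alpha> v \<Longrightarrow> is_V E \<alpha> v' \<Longrightarrow> v = v'"
  unfolding is_V_level by (rule level_unique)

lemma V_iff: "is_V E \<alpha> v \<Longrightarrow> E x v \<longleftrightarrow> (\<exists>\<gamma> w. E \<gamma> \<alpha> \<and> is_V E \<gamma> w \<and> subset E x w)"
  unfolding is_V_level by (rule level_iff)

lemma V_ordinal: "is_V E \<alpha> v \<Longrightarrow> is_ordinal E \<alpha>"
  unfolding is_V_def by blast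

lemma definable_V: "definable E False {} (\<lambda>e. is_V E (e i) (e j))"
  unfolding is_V_level by (rule definable_level[of "\<lambda>_. subset E", OF definable_subset power_step])

text \<open>Induction on membership inside a transitive set: Replacement bounds the stages that
  cover the members of y.\<close>

lemma V_covers: "\<exists>\<alpha> v. is_V E \<alpha> v \<and> subset E x v"
proof -
  define C where "C \<alpha> x \<longleftrightarrow> (\<exists>v. is_V E \<alpha> v \<and> subset E x v)" for \<alpha> x
  have defC: "definable E False {} (\<lambda>e. C (e i) (e j))" for i j
    unfolding C_def by (intro definable_rules definable_sets definable_V)
  obtain T where T: "trans_set E T" "E x T" using ex_transitive by blast
  have "\<exists>\<alpha>. C \<alpha> x"
  proof (rule set_induct[where Q = "\<lambda>x _ _ _ _. \<exists>\<alpha>. C \<alpha> x", OF _ _ T(2)])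
    show "definable E False {} (\<lambda>e. \<exists>\<alpha>. C \<alpha> (e 0))" by (intro definable_rules defC)
  next
    fix y assume y: "E y T" and IH1: "\<And>z. E z y \<Longrightarrow> E z T \<Longrightarrow> \<exists>\<alpha>. C \<alpha> z"
    have IH: "\<exists>\<alpha>. C \<alpha> z" if "E z y" for z
      using IH1[OF that] T(1) y that unfolding trans_set_def subset_def by blast
    \<comment> \<open>Replacement needs one value for each z, hence the least covering
      stage.\<close>
    define L where "L = (\<lambda>z \<rho>. C \<rho> z \<and> (\<forall>\<beta>. E \<beta> \<rho> \<longrightarrow> \<not> C \<beta> z))"
    have L_ex: "\<exists>\<rho>. L z \<rho>" if z: "E z y" for z
    proof (rule ccontr)
      assume no: "\<nexists>\<rho>. L z \<rho>"
      obtain \<alpha> where \<alpha>: "C \<alpha> z" using IH[OF z] by blast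
      then have o: "is_ordinal E (scs \<alpha>)" using V_ordinal ordinal_scs unfolding C_def by blast
      have "\<not> C \<alpha> z"
      proof (rule set_induct[where Q = "\<lambda>\<alpha> z _ _ _. \<not> C \<alpha> z" and ?c1.0 = z and t = "scs \<alpha>"])
        show "definable E False {} (\<lambda>e. \<not> C (e 0) (e 1))" by (intro definable_rules defC)
        show "E \<alpha> (scs \<alpha>)" by (simp add: mem_scs)
        fix \<beta> assume \<beta>: "E \<beta> (scs \<alpha>)" and IH2: "\<And>\<gamma>. E \<gamma> \<beta> \<Longrightarrow> E \<gamma> (scs \<alpha>) \<Longrightarrow> \<not> C \<gamma> z"
        then have "\<not> C \<gamma> z" if "E \<gamma> \<beta>" for \<gamma> using that ordinal_trans[OF o \<beta>] by blast
        then show "\<not> C \<beta> z" using no unfolding L_def by blast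
      qed
      with \<alpha> show False by blast
    qed
    have L_unique: "\<rho> = \<rho>'" if "L z \<rho>" "L z \<rho>'" for z \<rho> \<rho>'
    proof -
      have "is_ordinal E \<rho>" "is_ordinal E \<rho>'"
        using that V_ordinal unfolding L_def C_def by blast+
      then show ?thesis using ordinal_linear that unfolding L_def by blast
    qed
    \<comment> \<open>A set covered by stage \<open>\<rho>\<close> is a member only of later stages;
      uniting the successors makes \<open>\<alpha>\<close> exceed every such
      \<open>\<rho>\<close>.\<close>
    define R where "R = (\<lambda>z \<sigma>. \<exists>\<rho>. L z \<rho> \<and> is_succ E \<rho> \<sigma>)"
    have "\<exists>B. \<forall>\<sigma>. E \<sigma> B \<longleftrightarrow> (\<exists>z. E z y \<and> R z \<sigma>)"
    proof (rule replace[where R = "\<lambda>z \<sigma> _ _. R z \<sigma>"])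
      show "definable E False {} (\<lambda>e. R (e 0) (e 1))"
        unfolding R_def L_def is_succ_def by (intro definable_rules defC)
      show "\<sigma> = \<tau>" if "R z \<sigma>" "R z \<tau>" for z \<sigma> \<tau>
        using that L_unique unfolding R_def is_succ_iff by blast
    qed
    then obtain B where B: "\<And>\<sigma>. E \<sigma> B \<longleftrightarrow> (\<exists>z. E z y \<and> R z \<sigma>)" by blast
    obtain \<alpha> where \<alpha>: "\<And>z. E z \<alpha> \<longleftrightarrow> (\<exists>\<sigma>. E \<sigma> B \<and> E z \<sigma>)" using union by metis
    have oB: "is_ordinal E \<sigma>" if "E \<sigma> B" for \<sigma>
    proof -
      obtain z \<rho> where "L z \<rho>" "\<sigma> = scs \<rho>" using \<open>E \<sigma> B\<close> B unfolding R_def is_succ_iff by blast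
      moreover have "is_ordinal E \<rho>" using \<open>L z \<rho>\<close> V_ordinal unfolding L_def C_def by blast
      ultimately show ?thesis using ordinal_scs by simp
    qed
    have "is_ordinal E \<alpha>" unfolding is_ordinal_def
    proof (intro conjI allI impI)
      show "trans_set E \<alpha>" unfolding trans_set_def subset_def
      proof (intro allI impI)
        fix a b assume "E a \<alpha>" "E b a"
        then obtain \<sigma> where \<sigma>: "E \<sigma> B" "E a \<sigma>" using \<alpha> by blast
        then have "E b \<sigma>" using ordinal_trans[OF oB] \<open>E b a\<close> by blast
        then show "E b \<alpha>" using \<sigma>(1) \<alpha> by blast
      qed
      fix a assume "E a \<alpha>"
      then obtain \<sigma> where "E \<sigma> B" "E a \<sigma>" using \<alpha> by blast
      then show "trans_set E a" using oB unfolding is_ordinal_def by blast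
    qed
    then obtain v where v: "is_V E \<alpha> v" using V_exists by blast
    have "E z v" if z: "E z y" for z
    proof -
      obtain \<rho> where \<rho>: "L z \<rho>" using L_ex[OF z] by blast
      then have "E (scs \<rho>) B" using z B unfolding R_def is_succ_iff by blast
      then have "E \<rho> \<alpha>" using \<alpha> mem_scs by blast
      moreover obtain w where "is_V E \<rho> w" "subset E z w" using \<rho> unfolding L_def C_def by blast
      ultimately show ?thesis using V_iff[OF v] by blast
    qed
    then show "\<exists>\<alpha>. C \<alpha> y" using v unfolding C_def subset_def by blast
  qed
  then show ?thesis unfolding C_def by blast
qed

section \<open>Validity of S5 and \<open>\<Sigma>\<^sub>2\<close>-elementarity\<close>

definition covers :: "'a \<Rightarrow> (nat \<Rightarrow> 'a) \<Rightarrow> 'a fm \<Rightarrow> bool" where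
  "covers N e \<phi> \<longleftrightarrow> trans_set E N \<and> params \<phi> \<subseteq> ext E N \<and> (\<forall>n\<in>fv \<phi>. E (e n) N)"

lemma Delta0_absolute:
  "Delta0_fm \<phi> \<Longrightarrow> covers N e \<phi> \<Longrightarrow> sat E (ext E N) e \<phi> = sat E UNIV e \<phi>"
proof (induction arbitrary: e rule: Delta0_fm.induct)
  case (3 \<phi>)
  then show ?case by (simp add: covers_def)
next
  case (4 \<phi> \<psi>)
  then show ?case by (simp add: covers_def)
next
  case (5 \<phi> t n)
  have val: "val (e(n := x)) t = val e t" for x using 5(2) by (cases t) auto
  have "E (val e t) N" using 5(2,4) by (cases t) (auto simp: covers_def ext_def)
  then have tr: "E x N" if "E x (val e t)" for x
    using that 5(4) unfolding covers_def trans_set_def subset_def by blast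
  have "covers N (e(n := x)) \<phi>" if "E x N" for x
    using 5(4) that by (auto simp: covers_def)
  then show ?case using tr 5(3) by (auto simp: val ext_def)
next
  case (6 \<phi> t n)
  have val: "val (e(n := x)) t = val e t" for x using 6(2) by (cases t) auto
  have "E (val e t) N" using 6(2,4) by (cases t) (auto simp: covers_def ext_def FImp_def)
  then have tr: "E x N" if "E x (val e t)" for x
    using that 6(4) unfolding covers_def trans_set_def subset_def by blast
  have "covers N (e(n := x)) \<phi>" if "E x N" for x
    using 6(4) that by (auto simp: covers_def FImp_def)
  then show ?case using tr 6(3) by (auto simp: val ext_def FImp_def)
qed auto

lemma covers_mono:
  assumes "covers N e \<phi>" and "trans_set E W" and "subset E N W"
  shows "covers W e \<phi>"
  using assms unfolding covers_def subset_def ext_def by blast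

lemma Pi1_down:
  "Pi_fm (Suc 0) \<phi> \<Longrightarrow> covers N e \<phi> \<Longrightarrow> sat E UNIV e \<phi> \<Longrightarrow> sat E (ext E N) e \<phi>"
proof (induction arbitrary: e rule: Pi1_induct)
  case (Delta0 \<phi>)
  then show ?case using Delta0_absolute by blast
next
  case (All k \<phi>)
  have "covers N (e(k := x)) \<phi>" if "E x N" for x using All.prems(1) that by (auto simp: covers_def)
  then show ?case using All.IH All.prems(2) by (auto simp: ext_def)
qed

lemma extend_cover:
  assumes "trans_set E N" and "params \<phi> \<subseteq> ext E N" and "\<And>n. n \<in> fv \<phi> - {k} \<Longrightarrow> E (e n) N"
  shows "\<exists>N'. trans_set E N' \<and> subset E N N' \<and> E x N' \<and> covers N' (e(k := x)) \<phi>"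
proof -
  obtain N' where "trans_set E N'" "subset E N N'" "E x N'" using ex_transitive by blast
  then show ?thesis using assms by (auto simp: covers_def subset_def ext_def intro!: exI[of _ N'])
qed

lemma subset_trans: "subset E x y \<Longrightarrow> subset E y z \<Longrightarrow> subset E x z"
  unfolding subset_def by blast

lemma subset_refl: "subset E x x"
  unfolding subset_def by blast

section \<open>Possible necessity and the passage from S5 to elementarity\<close>

text \<open>This is \<open>Dia (Box _)\<close> at N, but for a predicate of worlds, so that open
  formulas under an assignment are covered too.\<close>

definition eventually_true :: "'a \<Rightarrow> ('a \<Rightarrow> bool) \<Rightarrow> bool" where
  "eventually_true N P \<longleftrightarrow> (\<exists>W. trans_set E W \<and> subset E N W \<and>
    (\<forall>U. trans_set E U \<and> subset E W U \<longrightarrow> P U))"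

lemma Pi1_refuted:
  "Pi_fm (Suc 0) \<phi> \<Longrightarrow> covers N e \<phi> \<Longrightarrow> \<not> sat E UNIV e \<phi> \<Longrightarrow>
    eventually_true N (\<lambda>U. \<not> sat E (ext E U) e \<phi>)"
proof (induction arbitrary: N e rule: Pi1_induct)
  case (Delta0 \<phi>)
  have "\<not> sat E (ext E U) e \<phi>" if "trans_set E U" "subset E N U" for U
    using Delta0_absolute[OF Delta0(1) covers_mono[OF Delta0(2) that]] Delta0(3) by simp
  then show ?case using Delta0(2) subset_refl unfolding eventually_true_def covers_def by blast
next
  case (All k \<phi>)
  obtain x where x: "\<not> sat E UNIV (e(k := x)) \<phi>" using All.prems(2) by auto
  obtain N' where N': "trans_set E N'" "subset E N N'" "E x N'" "covers N' (e(k := x)) \<phi>"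
    using extend_cover[of N \<phi> k e x] All.prems(1) by (auto simp: covers_def)
  obtain W where W: "trans_set E W" "subset E N' W"
    "\<And>U. trans_set E U \<and> subset E W U \<Longrightarrow> \<not> sat E (ext E U) (e(k := x)) \<phi>"
    using All.IH[OF N'(4) x] unfolding eventually_true_def by blast
  have "\<not> sat E (ext E U) e (FAll k \<phi>)" if "trans_set E U \<and> subset E W U" for U
  proof -
    have "E x U" using that W(2) N'(3) unfolding subset_def by blast
    then show ?thesis using W(3)[OF that] by (auto simp: ext_def)
  qed
  then show ?case using W(1) subset_trans[OF N'(2) W(2)] unfolding eventually_true_def by blast
qed

lemma Sigma2_persists:
  "Sigma_fm 2 \<phi> \<Longrightarrow> covers N e \<phi> \<Longrightarrow> sat E UNIV e \<phi> \<Longrightarrow>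
    eventually_true N (\<lambda>U. sat E (ext E U) e \<phi>)"
proof (induction arbitrary: N e rule: Sigma2_induct)
  case (Pi1 \<phi>)
  have "sat E (ext E U) e \<phi>" if "trans_set E U" "subset E N U" for U
    using Pi1_down[OF Pi1(1) covers_mono[OF Pi1(2) that] Pi1(3)] .
  then show ?case using Pi1(2) subset_refl unfolding eventually_true_def covers_def by blast
next
  case (Ex k \<phi>)
  obtain x where x: "sat E UNIV (e(k := x)) \<phi>" using Ex.prems(2) by auto
  obtain N' where N': "trans_set E N'" "subset E N N'" "E x N'" "covers N' (e(k := x)) \<phi>"
    using extend_cover[of N \<phi> k e x] Ex.prems(1) by (auto simp: covers_def)
  obtain W where W: "trans_set E W" "subset E N' W"
    "\<And>U. trans_set E U \<and> subset E W U \<Longrightarrow> sat E (ext E U) (e(k := x)) \<phi>"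
    using Ex.IH[OF N'(4) x] unfolding eventually_true_def by blast
  have "sat E (ext E U) e (FEx k \<phi>)" if "trans_set E U \<and> subset E W U" for U
  proof -
    have "E x U" using that W(2) N'(3) unfolding subset_def by blast
    then show ?thesis using W(3)[OF that] by (auto simp: ext_def)
  qed
  then show ?case using W(1) subset_trans[OF N'(2) W(2)] unfolding eventually_true_def by blast
qed

lemma S5_reflects:
  assumes S5: "S5 \<subseteq> Val E M (lang E M)" and \<phi>: "\<phi> \<in> lang E M"
    and ev: "eventually_true M (\<lambda>U. models E (ext E U) \<phi>)"
  shows "models E (ext E M) \<phi>"
proof -
  have "MImp (Dia (Box (Atom 0))) (Atom 0) \<in> Val E M (lang E M)"
    using S5 S5.Five by blast
  then have "true_at E M (map_modal (\<lambda>_ :: nat. \<phi>) (MImp (Dia (Box (Atom 0))) (Atom 0)))"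
    by (rule ValD) (use \<phi> in auto)
  with ev show ?thesis unfolding eventually_true_def by auto
qed

lemma Sigma_elementary_if_S5:
  assumes M: "trans_set E M" and S5: "S5 \<subseteq> Val E M (lang E M)"
  shows "Sigma_elementary E 2 M"
proof -
  have up: "sat E UNIV e \<phi>"
    if "Sigma_fm 2 \<phi>" "covers M e \<phi>" "sat E (ext E M) e \<phi>" for \<phi> e
    using that
  proof (induction arbitrary: e rule: Sigma2_induct)
    case (Pi1 \<phi>)
    show ?case
    proof (rule ccontr)
      assume "\<not> sat E UNIV e \<phi>"
      then have ev: "eventually_true M (\<lambda>U. sat E (ext E U) e (FNeg \<phi>))"
        using Pi1_refuted Pi1 by simp
      \<comment> \<open>The quantifiers already stripped left values in e; they lie in M, so the
        formula becomes a sentence to which the S5 axiom applies.\<close>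
      obtain \<psi> where \<psi>: "\<psi> \<in> lang E M" "\<And>D. models E D \<psi> \<longleftrightarrow> sat E D e (FNeg \<phi>)"
        using close_fm[of "FNeg \<phi>" E M e] Pi1(2) by (auto simp: covers_def)
      have "sat E (ext E M) e (FNeg \<phi>)"
        using S5_reflects[OF S5 \<psi>(1)] ev unfolding \<psi>(2) by blast
      then show False using Pi1(3) by simp
    qed
  next
    case (Ex k \<phi>)
    obtain x where x: "E x M" "sat E (ext E M) (e(k := x)) \<phi>" using Ex.prems(2) by (auto simp: ext_def)
    have "covers M (e(k := x)) \<phi>" using Ex.prems(1) x(1) by (auto simp: covers_def)
    then show ?case using Ex.IH x(2) by auto
  qed
  show ?thesis unfolding Sigma_elementary_def
  proof (intro ballI impI)
    fix \<phi> assume \<phi>: "\<phi> \<in> lang E M" "Sigma_fm 2 \<phi>"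
    then have fv: "fv \<phi> = {}" and cov: "covers M e \<phi>" for e
      using M by (auto simp: lang_def covers_def)
    note ms = models_sentence[OF fv, where e = undefined]
    show "models E (ext E M) \<phi> \<longleftrightarrow> models E UNIV \<phi>"
    proof
      show "models E (ext E M) \<phi> \<Longrightarrow> models E UNIV \<phi>" unfolding ms using up \<phi>(2) cov by blast
      assume "models E UNIV \<phi>"
      then show "models E (ext E M) \<phi>"
        using S5_reflects[OF S5 \<phi>(1)] Sigma2_persists[OF \<phi>(2) cov] unfolding ms by blast
    qed
  qed
qed

section \<open>Reflecting Sigma_2 statements into M\<close>

text \<open>Elementarity is used twice. A further existential quantifier keeps the formula Sigma_2,
  so the existence statement goes down to M; the instance found there goes back up to the
  universe.\<close>

lemma Sigma_elementary_witness:
  assumes M: "Sigma_elementary E 2 M" and P: "Sigma2_definable E A P" and A: "A \<subseteq> ext E M"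
    and e: "\<And>n. E (e n) M" and x: "P (case_nat x e)"
  shows "\<exists>x. E x M \<and> P (case_nat x e)"
proof -
  have transfer: "dsat E (ext E M) e \<psi> \<longleftrightarrow> dsat E UNIV e \<psi>"
    if "db_Sigma2 \<psi>" "set_db \<psi> \<subseteq> A" "\<And>n. E (e n) M" for \<psi> e
  proof -
    let ?\<phi> = "to_fm 0 (\<lambda>i. Par (e i)) \<psi>"
    have "params ?\<phi> \<subseteq> ext E M" using that A by (intro params_to_fm) (auto simp: ext_def)
    moreover have fv: "fv ?\<phi> = {}" using fv_to_fm[OF fresh_from_Par, of e \<psi>] by simp
    ultimately have "?\<phi> \<in> lang E M" by (simp add: lang_def)
    then have "models E (ext E M) ?\<phi> \<longleftrightarrow> models E UNIV ?\<phi>"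
      using M Sigma2_to_fm[OF that(1) fresh_from_Par] unfolding Sigma_elementary_def by blast
    then show ?thesis
      by (simp add: models_sentence[OF fv, where e = undefined] sat_to_fm fresh_from_Par)
  qed
  obtain \<psi> where \<psi>: "db_Sigma2 \<psi>" "set_db \<psi> \<subseteq> A" "\<And>e. dsat E UNIV e \<psi> \<longleftrightarrow> P e"
    using P unfolding Sigma2_definable_def by blast
  then have "dsat E UNIV e (DEx \<psi>)" using x by auto
  then have "dsat E (ext E M) e (DEx \<psi>)" using transfer[of "DEx \<psi>" e] \<psi> e by simp
  then obtain y where y: "E y M" "dsat E (ext E M) (case_nat y e) \<psi>" by (auto simp: ext_def)
  have "E (case_nat y e n) M" for n using y(1) e by (simp split: nat.split)
  then show ?thesis using transfer[OF \<psi>(1,2)] y \<psi>(3) by blast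
qed

text \<open>The empty set is transitive, so only elementarity excludes it. The element obtained
  fills the free parameter slots in \<open>elementary_reflects\<close>.\<close>

lemma Sigma_elementary_nonempty:
  assumes "Sigma_elementary E 2 M"
  shows "\<exists>m. E m M"
proof -
  let ?\<phi> = "FEx 0 (FEq (Var 0) (Var 0)) :: 'a fm"
  have "Sigma_fm 2 ?\<phi>" unfolding numeral_2_eq_2
    by (intro Sigma_fm_Pi_fm.intros Delta0_fm.intros)
  moreover have "?\<phi> \<in> lang E M" by (simp add: lang_def)
  ultimately have "models E (ext E M) ?\<phi> \<longleftrightarrow> models E UNIV ?\<phi>"
    using assms unfolding Sigma_elementary_def by blast
  then show ?thesis by (auto simp: models_def ext_def)
qed

lemma Sigma_elementary_witness3:
  assumes M: "Sigma_elementary E 2 M"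
    and Q: "Sigma2_definable E A (\<lambda>e. Q (e 0) (e 1) (e 2))" and A: "A \<subseteq> ext E M"
    and c: "E c1 M" "E c2 M" and x: "Q x c1 c2"
  shows "\<exists>x. E x M \<and> Q x c1 c2"
  using Sigma_elementary_witness[OF M Q A, of "case_nat c1 (\<lambda>_. c2)" x] c x
  by (auto split: nat.split simp: numeral_2_eq_2)

text \<open>
  Bounding the range of \<open>f\<close> by \<open>t\<close> leaves \<open>x\<close> as the only unbounded variable, so that \<open>V\<^sub>\<alpha> = v\<close> is \<open>\<Sigma>\<^sub>2\<close>.
\<close>

definition V_matrix :: "'a \<Rightarrow> 'a \<Rightarrow> 'a \<Rightarrow> 'a \<Rightarrow> 'a \<Rightarrow> 'a \<Rightarrow> bool" where
  "V_matrix f s t \<alpha> v x \<longleftrightarrow> E \<alpha> s \<and> trans_set E s \<and> (\<forall>\<beta>. E \<beta> s \<longrightarrow> is_ordinal E \<beta>) \<and>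
    E v t \<and> maps_to E f \<alpha> v \<and> (\<forall>\<beta>. E \<beta> s \<longrightarrow> (\<exists>u. E u t \<and> maps_to E f \<beta> u)) \<and>
    (\<forall>\<beta>. E \<beta> s \<longrightarrow> (\<forall>u. E u t \<longrightarrow> maps_to E f \<beta> u \<longrightarrow>
      (E x u \<longleftrightarrow> (\<exists>\<gamma>. E \<gamma> \<beta> \<and> (\<exists>w. E w t \<and> maps_to E f \<gamma> w \<and> subset E x w)))))"

lemma definable_V_matrix: "definable E b A (\<lambda>e. V_matrix (e i) (e j) (e k) (e l) (e m) (e n))"
  unfolding V_matrix_def by (intro definable_rules definable_sets)

text \<open>For Kuratowski pairs u lies in \<open>{x, u}\<close>, which lies in the pair, which lies
  in f: two unions suffice.\<close>

lemma ex_range_bound: "\<exists>t. \<forall>x u. maps_to E f x u \<longrightarrow> E u t"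
proof -
  obtain a where a: "\<And>z. E z a \<longleftrightarrow> (\<exists>y. E y f \<and> E z y)" using union by metis
  obtain t where t: "\<And>z. E z t \<longleftrightarrow> (\<exists>y. E y a \<and> E z y)" using union by metis
  have "E u t" if "maps_to E f x u" for x u
  proof -
    have "E (upr x u) a" using that a unfolding maps_to_iff pr_def using mem_upr by blast
    then show ?thesis using t mem_upr by blast
  qed
  then show ?thesis by blast
qed

lemma is_V_prenex: "is_V E \<alpha> v \<longleftrightarrow> (\<exists>f s t. \<forall>x. V_matrix f s t \<alpha> v x)"
proof
  assume "is_V E \<alpha> v"
  then obtain f s where f: "attempt (subset E) f s" "E \<alpha> s" "maps_to E f \<alpha> v"
    unfolding is_V_level level_def by blast
  obtain t where t: "\<And>x u. maps_to E f x u \<Longrightarrow> E u t" using ex_range_bound by blast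
  have "V_matrix f s t \<alpha> v x" for x unfolding V_matrix_def
  proof (intro conjI allI impI)
    show "E \<alpha> s" "maps_to E f \<alpha> v" "E v t" using f t by blast+
    show "trans_set E s" using f(1) unfolding attempt_def by blast
    fix \<beta> assume \<beta>: "E \<beta> s"
    then show "is_ordinal E \<beta>" using f(1) unfolding attempt_def by simp
    show "\<exists>u. E u t \<and> maps_to E f \<beta> u" using attempt_total[OF f(1) \<beta>] t by blast
    fix u assume "maps_to E f \<beta> u"
    from attempt_step[OF f(1) \<beta> this, of x]
    show "E x u \<longleftrightarrow> (\<exists>\<gamma>. E \<gamma> \<beta> \<and> (\<exists>w. E w t \<and> maps_to E f \<gamma> w \<and> subset E x w))"
      using t by blast
  qed
  then show "\<exists>f s t. \<forall>x. V_matrix f s t \<alpha> v x" by blast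
next
  assume "\<exists>f s t. \<forall>x. V_matrix f s t \<alpha> v x"
  then obtain f s t where m: "\<And>x. V_matrix f s t \<alpha> v x" by blast
  \<comment> \<open>These conjuncts do not mention x, so an arbitrary instance yields them.\<close>
  have s: "E \<alpha> s" "trans_set E s" and v: "E v t" "maps_to E f \<alpha> v"
    using m[of undefined] unfolding V_matrix_def by simp_all
  have o: "is_ordinal E \<beta>" if "E \<beta> s" for \<beta>
    using m[of undefined] that unfolding V_matrix_def by simp
  have total: "\<exists>u. E u t \<and> maps_to E f \<beta> u" if "E \<beta> s" for \<beta>
    using m[of undefined] that unfolding V_matrix_def by simp
  have step: "E x u \<longleftrightarrow> (\<exists>\<gamma>. E \<gamma> \<beta> \<and> (\<exists>w. E w t \<and> maps_to E f \<gamma> w \<and> subset E x w))"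
    if "E \<beta> s" "E u t" "maps_to E f \<beta> u" for \<beta> u x
    using m[of x] that unfolding V_matrix_def by simp
  \<comment> \<open>\<open>V_matrix\<close> says nothing about values of f outside t, so the claim
    is confined to values in t.\<close>
  define Q where "Q = (\<lambda>\<beta> t f. \<forall>u. E u t \<longrightarrow> maps_to E f \<beta> u \<longrightarrow> is_V E \<beta> u)"
  have "Q \<alpha> t f"
  proof (rule set_induct[where Q = "\<lambda>\<beta> t f _ _. Q \<beta> t f", OF _ _ s(1)])
    show "definable E False {} (\<lambda>e. Q (e 0) (e 1) (e 2))"
      unfolding Q_def by (intro definable_rules definable_sets definable_V)
  next
    fix \<beta> assume \<beta>: "E \<beta> s" and IH1: "\<And>\<gamma>. E \<gamma> \<beta> \<Longrightarrow> E \<gamma> s \<Longrightarrow> Q \<gamma> t f"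
    have \<gamma>s: "E \<gamma> s" if "E \<gamma> \<beta>" for \<gamma> using s(2) \<beta> that unfolding trans_set_def subset_def by blast
    have IH: "is_V E \<gamma> w" if "E \<gamma> \<beta>" "E w t" "maps_to E f \<gamma> w" for \<gamma> w
      using IH1[OF that(1) \<gamma>s[OF that(1)]] that(2,3) unfolding Q_def by blast
    show "Q \<beta> t f" unfolding Q_def
    proof (intro allI impI)
      fix u assume u: "E u t" "maps_to E f \<beta> u"
      obtain u' where u': "is_V E \<beta> u'" using V_exists[OF o[OF \<beta>]] by blast
      have eq: "(\<exists>w. E w t \<and> maps_to E f \<gamma> w \<and> subset E x w) \<longleftrightarrow> (\<exists>w. is_V E \<gamma> w \<and> subset E x w)"
        if \<gamma>: "E \<gamma> \<beta>" for \<gamma> x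
      proof -
        obtain w where w: "E w t" "maps_to E f \<gamma> w" using total[OF \<gamma>s[OF \<gamma>]] by blast
        have "is_V E \<gamma> w" by (rule IH[OF \<gamma> w])
        then have "w' = w" if "is_V E \<gamma> w'" for w' using V_unique that by blast
        then have "(\<exists>w. is_V E \<gamma> w \<and> subset E x w) \<longleftrightarrow> subset E x w"
          using \<open>is_V E \<gamma> w\<close> by blast
        moreover have "w' = w" if "E w' t" "maps_to E f \<gamma> w'" for w'
          using V_unique[OF IH[OF \<gamma> that] \<open>is_V E \<gamma> w\<close>] .
        ultimately show ?thesis using w by blast
      qed
      have "u = u'"
      proof (rule set_eqI)
        fix x
        show "E x u \<longleftrightarrow> E x u'" unfolding step[OF \<beta> u, of x] V_iff[OF u', of x] using eq[of _ x] by blast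
      qed
      with u' show "is_V E \<beta> u" by simp
    qed
  qed
  then show "is_V E \<alpha> v" using v unfolding Q_def by blast
qed

section \<open>M is a stage of the cumulative hierarchy, indexed by a cardinal\<close>

context
  fixes M
  assumes M: "trans_set E M" and elem: "Sigma_elementary E 2 M"
begin

lemma M_trans: "E x M \<Longrightarrow> E y x \<Longrightarrow> E y M"
  using M unfolding trans_set_def subset_def by blast

text \<open>Being the power set takes one unbounded universal quantifier, so it is the true power
  set that lies in M, and M is closed under subsets.\<close>

lemma power_in_M:
  assumes "E a M"
  shows "\<exists>p. E p M \<and> (\<forall>y. E y p \<longleftrightarrow> subset E y a)"
proof -
  have "Sigma2_definable E {} (\<lambda>e. \<forall>y. E y (e 0) \<longleftrightarrow> subset E y (e 1))"
    by (intro Sigma2_definable_Pi1 Pi1_definable_all Pi1_definable_bounded definable_rules definable_sets)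
  then show ?thesis
    using Sigma_elementary_witness3[OF elem, of "{}" "\<lambda>p a _. \<forall>y. E y p \<longleftrightarrow> subset E y a"]
      assms power_set by blast
qed

lemma subset_in_M: "E a M \<Longrightarrow> subset E y a \<Longrightarrow> E y M"
  using power_in_M M_trans by blast

lemma V_in_M:
  assumes "E \<alpha> M" and "is_V E \<alpha> v"
  shows "E v M"
proof -
  have "Sigma2_definable E {} (\<lambda>e. is_V E (e 1) (e 0))"
    unfolding is_V_prenex
    by (intro Sigma2_definable_ex Sigma2_definable_Pi1 Pi1_definable_all Pi1_definable_bounded
        definable_V_matrix)
  then have "\<exists>v. E v M \<and> is_V E \<alpha> v"
    using Sigma_elementary_witness3[OF elem, of "{}" "\<lambda>v \<alpha> _. is_V E \<alpha> v"] assms by blast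
  then show ?thesis using V_unique assms(2) by blast
qed

lemma rank_in_M:
  assumes "E x M"
  shows "\<exists>\<alpha>. E \<alpha> M \<and> (\<exists>v. is_V E \<alpha> v \<and> subset E x v)"
proof -
  \<comment> \<open>Prenex form: the witnesses for the hierarchy move to the front, and
    \<open>subset\<close> moves under the universal quantifier.\<close>
  have *: "(\<exists>v. is_V E \<alpha> v \<and> subset E x v) \<longleftrightarrow>
      (\<exists>v f s t. \<forall>z. V_matrix f s t \<alpha> v z \<and> subset E x v)" for \<alpha> x
    unfolding is_V_prenex by simp
  have "Sigma2_definable E {} (\<lambda>e. \<exists>v. is_V E (e 0) v \<and> subset E (e 1) v)"
    unfolding *
    by (intro Sigma2_definable_ex Sigma2_definable_Pi1 Pi1_definable_all Pi1_definable_bounded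
        definable_and definable_V_matrix definable_subset)
  then show ?thesis
    using Sigma_elementary_witness3[OF elem, of "{}" "\<lambda>\<alpha> x _. \<exists>v. is_V E \<alpha> v \<and> subset E x v"]
      assms V_covers by blast
qed

lemma M_is_V: "\<exists>\<delta>. is_V E \<delta> M \<and> (\<forall>\<alpha>. E \<alpha> \<delta> \<longleftrightarrow> E \<alpha> M \<and> is_ordinal E \<alpha>)"
proof -
  have "definable E False {} (\<lambda>e. is_ordinal E (e 0))" by (rule definable_ordinal)
  from separate[where Q = "\<lambda>\<alpha> _ _ _ _. is_ordinal E \<alpha>", OF this]
  obtain \<delta> where \<delta>: "\<And>\<alpha>. E \<alpha> \<delta> \<longleftrightarrow> E \<alpha> M \<and> is_ordinal E \<alpha>" by blast
  have "is_ordinal E \<delta>" unfolding is_ordinal_def[of E \<delta>]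
  proof (intro conjI allI impI)
    show "trans_set E \<delta>" unfolding trans_set_def subset_def
    proof (intro allI impI)
      fix x y assume "E x \<delta>" "E y x"
      then show "E y \<delta>" using M_trans[of x y] ordinal_mem[of x y] by (simp add: \<delta>)
    qed
    show "trans_set E x" if "E x \<delta>" for x using that by (simp add: \<delta> is_ordinal_def)
  qed
  then obtain v where v: "is_V E \<delta> v" using V_exists by blast
  have "v = M"
  proof (rule set_eqI)
    fix x
    show "E x v \<longleftrightarrow> E x M"
    proof
      assume "E x v"
      then obtain \<gamma> w where "E \<gamma> M" "is_V E \<gamma> w" "subset E x w" using V_iff[OF v] \<delta> by blast
      then show "E x M" using V_in_M subset_in_M by blast
    next
      assume "E x M"
      then obtain \<alpha> w where "E \<alpha> M" "is_V E \<alpha> w" "subset E x w" using rank_in_M by blast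
      then show "E x v" using V_iff[OF v] \<delta> V_ordinal by blast
    qed
  qed
  then show ?thesis using v \<delta> by blast
qed

text \<open>
  A bijection \<open>f : \<beta> \<rightarrow> \<delta>\<close> induces a well-order \<open>R \<in> M\<close> of \<open>\<beta>\<close> of type \<open>\<delta>\<close>; by elementarity \<open>R\<close> is
  isomorphic to some \<open>\<gamma> \<in> M\<close> as well, and uniqueness of the collapse gives \<open>\<gamma> = \<delta>\<close>.
\<close>

lemma no_bijection:
  assumes \<delta>: "\<And>\<alpha>. E \<alpha> \<delta> \<longleftrightarrow> E \<alpha> M \<and> is_ordinal E \<alpha>" and od: "is_ordinal E \<delta>"
    and \<beta>: "E \<beta> \<delta>" and bij: "is_bijection E f \<beta> \<delta>"
  shows False
proof -
  have f_total: "\<exists>u. maps_to E f x u" if "E x \<beta>" for x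
    using bij that unfolding is_bijection_def is_function_def by blast
  have f_unique: "u = u'" if "E x \<beta>" "maps_to E f x u" "maps_to E f x u'" for x u u'
    using bij that unfolding is_bijection_def is_function_def by blast
  have f_dom: "E x \<beta>" if "maps_to E f x u" for x u
  proof -
    have "E (pr x u) f" using that by (simp add: maps_to_iff)
    then obtain x' u' where "E x' \<beta>" "pr x u = pr x' u'"
      using bij unfolding is_bijection_def is_function_def is_opair_iff by blast
    then show ?thesis by (simp add: pr_eq)
  qed
  have f_ran: "E u \<delta>" if "maps_to E f x u" for x u
    using bij that unfolding is_bijection_def by blast
  have f_onto: "\<exists>x. maps_to E f x u" if "E u \<delta>" for u
    using bij that unfolding is_bijection_def by blast
  \<comment> \<open>Kuratowski pairs over \<open>\<beta>\<close> lie in its double power set q,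
    which is in M; hence every relation on \<open>\<beta>\<close> is in M.\<close>
  obtain p where p: "E p M" "\<And>y. E y p \<longleftrightarrow> subset E y \<beta>" using power_in_M \<beta> \<delta> by blast
  obtain q where q: "E q M" "\<And>y. E y q \<longleftrightarrow> subset E y p" using power_in_M p(1) by blast
  have pr_q: "E (pr x y) q" if "E x \<beta>" "E y \<beta>" for x y
    using that by (auto simp: q p subset_def pr_def mem_upr)
  define W where "W = (\<lambda>p f. \<exists>x y u v. is_opair E x y p \<and> maps_to E f x u \<and> maps_to E f y v \<and> E u v)"
  have "definable E False {} (\<lambda>e. W (e 0) (e 1))"
    unfolding W_def by (intro definable_rules definable_sets)
  from separate[where Q = "\<lambda>p f _ _ _. W p f", OF this]
  obtain R where R: "\<And>p. E p R \<longleftrightarrow> E p q \<and> W p f" by blast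
  have RM: "E R M" using subset_in_M[OF q(1)] R unfolding subset_def by blast
  have R_iff: "maps_to E R x y \<longleftrightarrow> E u v"
    if xy: "E x \<beta>" "E y \<beta>" and uv: "maps_to E f x u" "maps_to E f y v" for x y u v
  proof -
    have "maps_to E R x y \<longleftrightarrow> (\<exists>u v. maps_to E f x u \<and> maps_to E f y v \<and> E u v)"
      using pr_q[OF xy] unfolding maps_to_iff[of R] R W_def is_opair_iff pr_eq by blast
    also have "\<dots> \<longleftrightarrow> E u v" using f_unique[OF xy(1) uv(1)] f_unique[OF xy(2) uv(2)] uv by blast
    finally show ?thesis .
  qed
  \<comment> \<open>\<open>\<gamma>\<close> is transitive and g carries R to membership on it, so
    \<open>\<gamma>\<close> is the Mostowski collapse of R. All quantifiers are bounded, which makes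
    \<open>\<exists>g. I g \<gamma> \<beta> R\<close> a Sigma_2 condition.\<close>
  define I where "I = (\<lambda>g \<gamma> \<beta> R. trans_set E \<gamma> \<and>
    (\<forall>x. E x \<beta> \<longrightarrow> (\<exists>u. E u \<gamma> \<and> maps_to E g x u)) \<and>
    (\<forall>u. E u \<gamma> \<longrightarrow> (\<exists>x. E x \<beta> \<and> maps_to E g x u)) \<and>
    (\<forall>x. E x \<beta> \<longrightarrow> (\<forall>y. E y \<beta> \<longrightarrow> (\<forall>u. E u \<gamma> \<longrightarrow> (\<forall>v. E v \<gamma> \<longrightarrow>
      maps_to E g x u \<longrightarrow> maps_to E g y v \<longrightarrow> (maps_to E R x y \<longleftrightarrow> E u v))))))"
  have "I f \<delta> \<beta> R" unfolding I_def
  proof (intro conjI allI impI)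
    show "trans_set E \<delta>" using od unfolding is_ordinal_def by blast
    show "\<exists>u. E u \<delta> \<and> maps_to E f x u" if "E x \<beta>" for x using f_total[OF that] f_ran by blast
    show "\<exists>x. E x \<beta> \<and> maps_to E f x u" if "E u \<delta>" for u using f_onto[OF that] f_dom by blast
  qed (rule R_iff)
  moreover have "Sigma2_definable E {} (\<lambda>e. \<exists>g. I g (e 0) (e 1) (e 2))"
    unfolding I_def
    by (intro Sigma2_definable_ex Sigma2_definable_Pi1 Pi1_definable_bounded
        definable_rules definable_sets)
  \<comment> \<open>In the universe \<open>\<delta>\<close> itself is a witness; elementarity
    exchanges it for one inside M.\<close>
  ultimately obtain \<gamma> g where \<gamma>: "E \<gamma> M" and g: "I g \<gamma> \<beta> R"
    using Sigma_elementary_witness3[OF elem, of "{}" "\<lambda>\<gamma> \<beta> R. \<exists>g. I g \<gamma> \<beta> R" \<beta> R \<delta>] RM \<beta> \<delta> by blast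
  have \<gamma>_trans: "E u' \<gamma>" if "E u \<gamma>" "E u' u" for u u'
    using g that unfolding I_def trans_set_def subset_def by blast
  have g_total: "\<exists>u. E u \<gamma> \<and> maps_to E g x u" if "E x \<beta>" for x
    using g that unfolding I_def by blast
  have g_onto: "\<exists>x. E x \<beta> \<and> maps_to E g x u" if "E u \<gamma>" for u
    using g that unfolding I_def by blast
  have g_iff: "maps_to E R x y \<longleftrightarrow> E u v"
    if "E x \<beta>" "E y \<beta>" "E u \<gamma>" "E v \<gamma>" "maps_to E g x u" "maps_to E g y v" for x y u v
    using g that unfolding I_def by blast
  \<comment> \<open>Uniqueness of the collapse: f and g agree at each element of
    \<open>\<beta>\<close>, by induction on its f-value w. Only values of g inside
    \<open>\<gamma>\<close> are constrained by I.\<close>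
  define C where "C = (\<lambda>w f g \<gamma>. \<forall>x u. maps_to E f x w \<longrightarrow> maps_to E g x u \<longrightarrow> E u \<gamma> \<longrightarrow> u = w)"
  have C: "C w f g \<gamma>" if "E w \<delta>" for w
  proof (rule set_induct[where Q = "\<lambda>w f g \<gamma> _. C w f g \<gamma>", OF _ _ that])
    show "definable E False {} (\<lambda>e. C (e 0) (e 1) (e 2) (e 3))"
      unfolding C_def by (intro definable_rules definable_sets)
  next
    fix w assume w: "E w \<delta>" and IH: "\<And>w'. E w' w \<Longrightarrow> E w' \<delta> \<Longrightarrow> C w' f g \<gamma>"
    show "C w f g \<gamma>" unfolding C_def
    proof (intro allI impI)
      fix x u assume x: "maps_to E f x w" and u: "maps_to E g x u" "E u \<gamma>"
      have x\<beta>: "E x \<beta>" by (rule f_dom[OF x])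
      show "u = w"
      proof (rule set_eqI)
        fix z
        show "E z u \<longleftrightarrow> E z w"
        proof
          assume z: "E z u"
          then have z\<gamma>: "E z \<gamma>" by (rule \<gamma>_trans[OF u(2)])
          then obtain y where y: "E y \<beta>" "maps_to E g y z" using g_onto by blast
          obtain w' where w': "maps_to E f y w'" using f_total[OF y(1)] by blast
          have "maps_to E R y x" using g_iff[OF y(1) x\<beta> z\<gamma> u(2) y(2) u(1)] z by blast
          then have "E w' w" using R_iff[OF y(1) x\<beta> w' x] by blast
          with IH[OF this f_ran[OF w']] w' y(2) z\<gamma> show "E z w" unfolding C_def by blast
        next
          assume z: "E z w"
          then have z\<delta>: "E z \<delta>" by (rule ordinal_trans[OF od w])
          then obtain y where y: "maps_to E f y z" using f_onto by blast
          then have y\<beta>: "E y \<beta>" by (rule f_dom)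
          obtain u' where u': "E u' \<gamma>" "maps_to E g y u'" using g_total[OF y\<beta>] by blast
          have "maps_to E R y x" using R_iff[OF y\<beta> x\<beta> y x] z by blast
          then have "E u' u" using g_iff[OF y\<beta> x\<beta> u'(1) u(2) u'(2) u(1)] by blast
          with IH[OF z z\<delta>] y u' show "E z u" unfolding C_def by blast
        qed
      qed
    qed
  qed
  have "\<gamma> = \<delta>"
  proof (rule set_eqI)
    fix z
    show "E z \<gamma> \<longleftrightarrow> E z \<delta>"
    proof
      assume z: "E z \<gamma>"
      then obtain x where x: "E x \<beta>" "maps_to E g x z" using g_onto by blast
      obtain w where w: "maps_to E f x w" using f_total[OF x(1)] by blast
      have "E w \<delta>" by (rule f_ran[OF w])
      with C[OF this] w x(2) z show "E z \<delta>" unfolding C_def by blast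
    next
      assume z: "E z \<delta>"
      then obtain x where x: "maps_to E f x z" using f_onto by blast
      obtain u where u: "E u \<gamma>" "maps_to E g x u" using g_total[OF f_dom[OF x]] by blast
      with C[OF z] x show "E z \<gamma>" unfolding C_def by blast
    qed
  qed
  then have "E \<delta> \<delta>" using \<gamma> od \<delta> by blast
  then show False using not_mem_self by blast
qed

lemma Sigma_correct_if_elementary: "\<exists>\<delta>. Sigma_correct_cardinal E 2 \<delta> \<and> is_V E \<delta> M"
proof -
  obtain \<delta> where V: "is_V E \<delta> M" and \<delta>: "\<And>\<alpha>. E \<alpha> \<delta> \<longleftrightarrow> E \<alpha> M \<and> is_ordinal E \<alpha>"
    using M_is_V by blast
  have "is_cardinal E \<delta>"
    unfolding is_cardinal_def using V_ordinal[OF V] no_bijection[OF \<delta> V_ordinal[OF V]] by blast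
  then show ?thesis using V elem unfolding Sigma_correct_cardinal_def by blast
qed

end

section \<open>From elementarity to the validity of S5\<close>

text \<open>A pattern of truth values has to be one sentence over M before it can be reflected;
  finitely many atoms allow a conjunction of literals.\<close>

lemma lang_pattern:
  assumes "finite A" and "\<And>n. \<sigma> n \<in> lang E M"
  shows "\<exists>\<chi>\<in>lang E M. \<forall>D. models E D \<chi> \<longleftrightarrow> (\<forall>n\<in>A. models E D (\<sigma> n) \<longleftrightarrow> t n)"
  using assms(1)
proof (induction A rule: finite_induct)
  case empty
  have "FAll 0 (FEq (Var 0) (Var 0)) \<in> lang E M" by (simp add: lang_def)
  moreover have "models E D (FAll 0 (FEq (Var 0) (Var 0)))" for D by (simp add: models_def)
  ultimately show ?case by auto
next
  case (insert n A)
  then obtain \<chi> where \<chi>: "\<chi> \<in> lang E M" "\<And>D. models E D \<chi> \<longleftrightarrow> (\<forall>n\<in>A. models E D (\<sigma> n) \<longleftrightarrow> t n)"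
    by blast
  define \<theta> where "\<theta> = (if t n then \<sigma> n else FNeg (\<sigma> n))"
  have "fv (\<sigma> n) = {}" using assms(2)[of n] by (simp add: lang_def)
  then have "models E D \<theta> \<longleftrightarrow> (models E D (\<sigma> n) \<longleftrightarrow> t n)" for D
    by (simp add: \<theta>_def models_neg)
  moreover have "FAnd \<theta> \<chi> \<in> lang E M" using assms(2)[of n] \<chi>(1) by (simp add: \<theta>_def lang_and lang_neg)
  ultimately show ?case using \<chi>(2) by (intro bexI[of _ "FAnd \<theta> \<chi>"]) (auto simp: models_and)
qed

text \<open>W may lie anywhere. Its reflection W' is a member of the transitive set M, hence a
  subset of M, and so the worlds above W' include all worlds above M.\<close>

lemma elementary_reflects:
  assumes M: "trans_set E M" and elem: "Sigma_elementary E 2 M" and \<phi>: "\<phi> \<in> lang E M"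
    and W: "trans_set E W" "\<And>U. trans_set E U \<Longrightarrow> subset E W U \<Longrightarrow> models E (ext E U) \<phi>"
    and U: "trans_set E U" "subset E M U"
  shows "models E (ext E U) \<phi>"
proof -
  obtain m where m: "E m M" using Sigma_elementary_nonempty[OF elem] by blast
  \<comment> \<open>\<open>trans_set E W\<close> is placed under the quantifier to leave one
    universal quantifier before a bounded matrix. The assignment is constantly U because variables
    have to be read from the environment; for a sentence the choice is immaterial.\<close>
  define Q where "Q W \<longleftrightarrow> (\<forall>U. trans_set E W \<and>
    (trans_set E U \<and> subset E W U \<longrightarrow> sat E (ext E U) (\<lambda>_. U) \<phi>))" for W
  have \<phi>': "fv \<phi> = {}" "params \<phi> \<subseteq> ext E M" using \<phi> by (auto simp: lang_def)
  have "Sigma2_definable E (params \<phi>) (\<lambda>e. Q (e 0))"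
    unfolding Q_def
    by (intro Sigma2_definable_Pi1 Pi1_definable_all Pi1_definable_bounded
        definable_and definable_imp definable_sets definable_relativized[where r = "\<lambda>_. _"] order_refl)
  moreover have "Q W" unfolding Q_def using W models_sentence[OF \<phi>'(1)] by blast
  ultimately obtain W' where W': "E W' M" "Q W'"
    using Sigma_elementary_witness3[OF elem, of "params \<phi>" "\<lambda>W _ _. Q W"] \<phi>'(2) m by blast
  have "subset E W' U" using W'(1) M U(2) unfolding trans_set_def subset_def by blast
  then have "sat E (ext E U) (\<lambda>_. U) \<phi>" using W'(2) U(1) unfolding Q_def by blast
  then show ?thesis using models_sentence[OF \<phi>'(1)] by blast
qed

text \<open>If a pattern realised above M were unattainable above some U, its negation would hold in
  all worlds above U, hence by reflection in all worlds above M. So T stays the same, and truth at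
  any world is truth in the universal model T.\<close>

lemma S5_if_elementary:
  assumes M: "trans_set E M" and elem: "Sigma_elementary E 2 M"
  shows "S5 \<subseteq> Val E M (lang E M)"
proof
  fix p assume p: "p \<in> S5"
  have "true_at E M (map_modal \<sigma> p)" if "range \<sigma> \<subseteq> lang E M" for \<sigma>
  proof -
    have \<sigma>: "\<sigma> n \<in> lang E M" for n using that by blast
    have fin: "finite (set_modal p)" by (induction p) auto
    \<comment> \<open>Cutting off at the atoms of p makes v U equal to a given valuation exactly
      when a finite pattern sentence holds.\<close>
    define v where "v U = (\<lambda>n. n \<in> set_modal p \<and> models E (ext E U) (\<sigma> n))" for U
    define T where "T = {v U | U. trans_set E U \<and> subset E M U}"
    have realize: "\<exists>U'. trans_set E U' \<and> subset E U U' \<and> v U' = t"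
      if U: "trans_set E U" "subset E M U" and t: "t \<in> T" for U t
    proof (rule ccontr)
      assume no: "\<nexists>U'. trans_set E U' \<and> subset E U U' \<and> v U' = t"
      obtain U0 where U0: "trans_set E U0" "subset E M U0" "t = v U0" using t unfolding T_def by blast
      obtain \<chi> where \<chi>: "\<chi> \<in> lang E M"
        "\<forall>D. models E D \<chi> \<longleftrightarrow> (\<forall>n\<in>set_modal p. models E D (\<sigma> n) \<longleftrightarrow> t n)"
        using lang_pattern[of "set_modal p" \<sigma> M t, OF fin \<sigma>] by (elim bexE)
      have eq: "v U' = t \<longleftrightarrow> models E (ext E U') \<chi>" for U'
        unfolding \<chi>(2)[rule_format] unfolding U0(3) by (auto simp: v_def fun_eq_iff)
      have fv: "fv \<chi> = {}" using \<chi>(1) by (simp add: lang_def)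
      have "models E (ext E U') (FNeg \<chi>)" if "trans_set E U'" "subset E U U'" for U'
        using no that eq[of U'] by (simp add: models_neg[OF fv])
      then have "models E (ext E U0) (FNeg \<chi>)"
        using elementary_reflects[OF M elem _ U(1) _ U0(1,2), of "FNeg \<chi>"] \<chi>(1) by (simp add: lang_neg)
      then show False using eq[of U0] U0(3) by (simp add: models_neg[OF fv])
    qed
    have T_eq: "T = v ` {U'. trans_set E U' \<and> subset E U U'}"
      if "trans_set E U" "subset E M U" for U
    proof
      show "T \<subseteq> v ` {U'. trans_set E U' \<and> subset E U U'}"
        using realize[OF that] by fastforce
      show "v ` {U'. trans_set E U' \<and> subset E U U'} \<subseteq> T"
        using subset_trans[OF that(2)] unfolding T_def by blast
    qed
    have truth: "true_at E U (map_modal \<sigma> q) \<longleftrightarrow> ksat T (v U) q"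
      if "set_modal q \<subseteq> set_modal p" "trans_set E U" "subset E M U" for q U
      using that
    proof (induction q arbitrary: U)
      case (Atom n)
      then show ?case by (simp add: v_def)
    next
      case (Box q)
      have IH: "true_at E U' (map_modal \<sigma> q) \<longleftrightarrow> ksat T (v U') q"
        if "trans_set E U'" "subset E U U'" for U'
        using Box.IH[OF _ that(1) subset_trans[OF Box.prems(3) that(2)]] Box.prems(1) by simp
      show ?case
        unfolding ksat.simps ball_image_Collect[OF T_eq[OF Box.prems(2,3)]] using IH by simp
    next
      case (Dia q)
      have IH: "true_at E U' (map_modal \<sigma> q) \<longleftrightarrow> ksat T (v U') q"
        if "trans_set E U'" "subset E U U'" for U'
        using Dia.IH[OF _ that(1) subset_trans[OF Dia.prems(3) that(2)]] Dia.prems(1) by simp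
      show ?case
        unfolding ksat.simps bex_image_Collect[OF T_eq[OF Dia.prems(2,3)]] using IH by auto
    qed auto
    have "v M \<in> T" using M subset_refl unfolding T_def by blast
    then show ?thesis using S5_sound[OF p] truth[OF order_refl M subset_refl] by simp
  qed
  then show "p \<in> Val E M (lang E M)" unfolding Val_def by blast
qed

section \<open>No validities beyond S5\<close>

text \<open>For an ordinal this reads "a limit plus k", with 0 counted as a limit, but worlds are
  arbitrary transitive sets. The conjunct \<open>E y x\<close> bounds the quantifier, so that
  transitive sets judge the property correctly.\<close>

fun succ_of_limit :: "nat \<Rightarrow> 'a \<Rightarrow> bool" where
  "succ_of_limit 0 x \<longleftrightarrow> (\<forall>y. E y x \<longrightarrow> (\<exists>z. E z x \<and> E y z))"
| "succ_of_limit (Suc k) x \<longleftrightarrow> (\<exists>y. E y x \<and> is_succ E y x \<and> succ_of_limit k y)"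

lemma definable_succ_of_limit: "definable E True {} (\<lambda>e. succ_of_limit k (e i))"
proof (induction k arbitrary: i)
  case 0
  show ?case unfolding succ_of_limit.simps by (intro definable_rules)
next
  case (Suc k)
  have *: "is_succ E y x \<longleftrightarrow> E y x \<and> (\<forall>z. E z y \<longrightarrow> E z x) \<and> (\<forall>z. E z x \<longrightarrow> E z y \<or> z = y)" for x y
    unfolding is_succ_def by blast
  show ?case unfolding succ_of_limit.simps * by (intro definable_rules Suc.IH)
qed

lemma succ_of_limit_Suc: "succ_of_limit (Suc k) (scs y) \<longleftrightarrow> succ_of_limit k y"
proof -
  have "y' = y" if "scs y = scs y'" for y'
  proof -
    have "E y (scs y')" "E y' (scs y)" using that mem_scs by metis+
    then show ?thesis using mem_asym unfolding mem_scs by blast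
  qed
  then show ?thesis by (auto simp: is_succ_iff mem_scs)
qed

lemma succ_of_limit_0: "\<not> succ_of_limit 0 (scs y)"
  using mem_asym[of y] not_mem_self[of y] by (auto simp: mem_scs)

lemma limit_not_succ: "succ_of_limit 0 x \<Longrightarrow> \<not> succ_of_limit (Suc k) x"
  using succ_of_limit_0 unfolding succ_of_limit.simps(2) is_succ_iff by blast

text \<open>
  If \<open>T\<close> is transitive without \<open>\<in>\<close>-maximal elements, its \<open>k\<close>-th successor is the only \<open>\<in>\<close>-maximal
  element of the \<open>(k + 1)\<close>-st, in which the dial therefore reads exactly \<open>k\<close>.
\<close>

definition dial :: "nat \<Rightarrow> 'a \<Rightarrow> bool" where
  "dial k U \<longleftrightarrow> (\<exists>x. E x U \<and> (\<forall>y. E y U \<longrightarrow> \<not> E x y) \<and> succ_of_limit k x)"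

text \<open>Maximality of x is a statement about U that U can make itself, and
  \<open>succ_of_limit k\<close> is absolute. Without parameters the sentence belongs to the
  language of every M.\<close>

lemma dial_fm:
  "\<exists>\<chi>. fv \<chi> = {} \<and> params \<chi> = {} \<and> (\<forall>U. trans_set E U \<longrightarrow> (models E (ext E U) \<chi> \<longleftrightarrow> dial k U))"
proof -
  obtain \<psi> where \<psi>: "db_bounded \<psi>" "set_db \<psi> = {}" "\<And>e. dsat E UNIV e \<psi> \<longleftrightarrow> succ_of_limit k (e 0)"
    using definable_succ_of_limit[of k 0] unfolding definable_def by auto
  \<comment> \<open>Sending every index to variable 0 leaves it as the only possible free variable;
    the truth of \<open>\<psi>\<close> depends on index 0 alone.\<close>
  define \<phi> where "\<phi> = to_fm 1 (\<lambda>_. Var 0) \<psi>"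
  have fresh: "fresh_from 1 (\<lambda>_. Var 0 :: 'a trm)" by (simp add: fresh_from_def)
  have fv: "fv \<phi> \<subseteq> {0}" using fv_to_fm[OF fresh, of \<psi>] by (auto simp: \<phi>_def)
  have par: "params \<phi> = {}" using params_to_fm[of "\<lambda>_. Var 0" "{}" \<psi> 1] \<psi>(2) by (simp add: \<phi>_def)
  have \<phi>: "sat E (ext E U) e \<phi> \<longleftrightarrow> succ_of_limit k (e 0)" if "trans_set E U" "E (e 0) U" for U e
  proof -
    have "covers U e \<phi>" using that fv par unfolding covers_def by auto
    then have "sat E (ext E U) e \<phi> \<longleftrightarrow> sat E UNIV e \<phi>"
      using Delta0_absolute Delta0_to_fm[OF \<psi>(1) fresh] unfolding \<phi>_def by blast
    then show ?thesis unfolding \<phi>_def sat_to_fm[OF fresh] \<psi>(3) by simp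
  qed
  let ?\<chi> = "FEx 0 (FAnd (FAll 1 (FNeg (FMem (Var 0) (Var 1)))) \<phi>)"
  have "fv ?\<chi> = {}" "params ?\<chi> = {}" using fv par by auto
  moreover have "models E (ext E U) ?\<chi> \<longleftrightarrow> dial k U" if "trans_set E U" for U
    using \<phi>[OF that] by (auto simp: models_def dial_def ext_def)
  ultimately show ?thesis by blast
qed

lemma dial_realized:
  assumes "trans_set E U"
  shows "\<exists>U'. trans_set E U' \<and> subset E U U' \<and> (\<forall>j. dial j U' \<longleftrightarrow> j = k)"
proof -
  \<comment> \<open>Passing to T erases whatever the top of U showed before.\<close>
  obtain T where T: "trans_set E T" "subset E U T" "succ_of_limit 0 T"
    using ex_transitive_unbounded[of U] unfolding succ_of_limit.simps by blast
  have scs_above: "trans_set E (scs S) \<and> subset E U (scs S)" if "trans_set E S" "subset E U S" for S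
    using that unfolding trans_set_def subset_def mem_scs by blast
  have "\<exists>S. (trans_set E S \<and> subset E U S) \<and> (\<forall>j. succ_of_limit j S \<longleftrightarrow> j = k)"
  proof (induction k)
    case 0
    have "succ_of_limit j T \<longleftrightarrow> j = 0" for j
      using T(3) limit_not_succ[OF T(3)] by (cases j) (simp_all del: succ_of_limit.simps)
    then show ?case using T(1,2) by (intro exI[of _ T] conjI allI)
  next
    case (Suc k)
    then obtain S where S: "trans_set E S" "subset E U S" "\<forall>j. succ_of_limit j S \<longleftrightarrow> j = k"
      by (elim exE conjE)
    have "succ_of_limit j (scs S) \<longleftrightarrow> j = Suc k" for j
    proof (cases j)
      case 0
      then show ?thesis using succ_of_limit_0 by (simp del: succ_of_limit.simps)
    next
      case (Suc i)
      then show ?thesis using S(3) by (simp add: succ_of_limit_Suc del: succ_of_limit.simps)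
    qed
    then show ?case using scs_above[OF S(1,2)] by (intro exI[of _ "scs S"] conjI[of "_ \<and> _"] allI)
  qed
  then obtain S where S: "trans_set E S" "subset E U S" "\<forall>j. succ_of_limit j S \<longleftrightarrow> j = k"
    by (elim exE conjE)
  have max: "E x (scs S) \<and> (\<forall>y. E y (scs S) \<longrightarrow> \<not> E x y) \<longleftrightarrow> x = S" for x
    using mem_asym[of S] not_mem_self[of S] by (auto simp: mem_scs)
  have "dial j (scs S) \<longleftrightarrow> (\<exists>x. x = S \<and> succ_of_limit j x)" for j
    unfolding dial_def max[symmetric] by (simp only: conj_assoc)
  then have "dial j (scs S) \<longleftrightarrow> j = k" for j using S(3) by simp
  then show ?thesis using scs_above[OF S(1,2)] by (intro exI[of _ "scs S"]) simp
qed

text \<open>An arbitrary world may show several readings or none. Taking the largest one up to m,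
  with 0 as default, gives every world exactly one value.\<close>

fun dial_value :: "nat \<Rightarrow> 'a \<Rightarrow> nat" where
  "dial_value 0 U = 0"
| "dial_value (Suc m) U = (if dial (Suc m) U then Suc m else dial_value m U)"

lemma dial_value_le: "dial_value m U \<le> m"
  by (induction m) (auto intro: le_SucI)

lemma dial_value_eq: "k \<le> m \<Longrightarrow> (\<And>j. dial j U \<longleftrightarrow> j = k) \<Longrightarrow> dial_value m U = k"
  by (induction m) auto

text \<open>Values are bounded by m, so an arbitrary HOL predicate b of the value is a finite
  Boolean combination of dial sentences.\<close>

lemma dial_value_fm:
  "\<exists>\<chi>\<in>lang E M. \<forall>U. trans_set E U \<longrightarrow> (models E (ext E U) \<chi> \<longleftrightarrow> b (dial_value m U))"
proof (induction m)
  case 0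
  let ?\<tau> = "FAll 0 (FEq (Var 0) (Var 0)) :: 'a fm"
  have "?\<tau> \<in> lang E M" "FNeg ?\<tau> \<in> lang E M" by (simp_all add: lang_def)
  moreover have "models E D ?\<tau>" "\<not> models E D (FNeg ?\<tau>)" for D by (simp_all add: models_def)
  ultimately show ?case by (cases "b 0") auto
next
  case (Suc m)
  then obtain \<chi> where \<chi>: "\<chi> \<in> lang E M"
    "\<And>U. trans_set E U \<Longrightarrow> models E (ext E U) \<chi> \<longleftrightarrow> b (dial_value m U)" by blast
  obtain \<delta> where \<delta>: "fv \<delta> = {}" "params \<delta> = {}"
    "\<And>U. trans_set E U \<Longrightarrow> models E (ext E U) \<delta> \<longleftrightarrow> dial (Suc m) U" using dial_fm by blast
  have \<chi>fv: "fv \<chi> = {}" using \<chi>(1) by (simp add: lang_def)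
  let ?\<theta> = "if b (Suc m) then FNeg (FAnd (FNeg \<delta>) (FNeg \<chi>)) else FAnd (FNeg \<delta>) \<chi>"
  have "?\<theta> \<in> lang E M" using \<chi>(1) \<delta>(1,2) by (auto simp: lang_def)
  moreover have "models E (ext E U) ?\<theta> \<longleftrightarrow> b (dial_value (Suc m) U)" if "trans_set E U" for U
    using \<chi>(2)[OF that] \<delta>(3)[OF that] by (simp add: models_neg models_and \<chi>fv \<delta>(1))
  ultimately show ?case by blast
qed

lemma Val_subset_S5:
  assumes M: "trans_set E M"
  shows "Val E M (lang E M) \<subseteq> S5"
proof
  fix p assume p: "p \<in> Val E M (lang E M)"
  show "p \<in> S5"
  proof (rule ccontr)
    assume "p \<notin> S5"
    then obtain T v where T: "finite T" "v \<in> T" "\<not> ksat T v p" using S5_complete_finite by blast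
    obtain m f where f: "T = f ` {i::nat. i < m}" using T(1) unfolding finite_conv_nat_seg_image by blast
    define g where "g i = (if i < m then f i else v)" for i
    let ?k = "dial_value m M"
    \<comment> \<open>h labels the readings 0 to m by valuations. M already shows \<open>?k\<close>,
      which must be labelled v; the label displaced by this moves to the spare reading m, so that
      all of T is still used.\<close>
    define h where "h j = (if j = ?k then v else if j = m then g ?k else g j)" for j
    have T_eq: "h ` {..m} = T"
    proof
      show "h ` {..m} \<subseteq> T" using f T(2) by (auto simp: h_def g_def)
      show "T \<subseteq> h ` {..m}"
      proof
        fix u assume "u \<in> T"
        then obtain i where i: "i < m" "u = f i" using f by blast
        show "u \<in> h ` {..m}"
        proof (cases "i = ?k")
          case True
          then have "h m = u" using i by (simp add: h_def g_def)
          then show ?thesis by blast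
        next
          case False
          then have "h i = u" using i by (simp add: h_def g_def)
          then show ?thesis using i(1) by force
        qed
      qed
    qed
    \<comment> \<open>Atom i is replaced by the sentence "the valuation labelling the current
      reading makes i true".\<close>
    have "\<forall>i. \<exists>\<chi>. \<chi> \<in> lang E M \<and>
        (\<forall>U. trans_set E U \<longrightarrow> (models E (ext E U) \<chi> \<longleftrightarrow> h (dial_value m U) i))"
      using dial_value_fm[of M "\<lambda>j. h j i" m for i] by blast
    from Hilbert_Choice.choice[OF this] obtain \<sigma> where \<sigma>: "\<And>i. \<sigma> i \<in> lang E M"
      "\<And>i U. trans_set E U \<Longrightarrow> models E (ext E U) (\<sigma> i) \<longleftrightarrow> h (dial_value m U) i" by blast
    have reach: "\<exists>U'. trans_set E U' \<and> subset E U U' \<and> h (dial_value m U') = t"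
      if U: "trans_set E U" and t: "t \<in> T" for U t
    proof -
      obtain k where k: "k \<le> m" "t = h k" using t T_eq by blast
      obtain U' where "trans_set E U'" "subset E U U'" "\<forall>j. dial j U' \<longleftrightarrow> j = k"
        using dial_realized[OF U] by blast
      then show ?thesis using k dial_value_eq[OF k(1), of U'] by blast
    qed
    have T_image: "T = (\<lambda>U'. h (dial_value m U')) ` {U'. trans_set E U' \<and> subset E U U'}"
      if "trans_set E U" for U
    proof
      show "T \<subseteq> (\<lambda>U'. h (dial_value m U')) ` {U'. trans_set E U' \<and> subset E U U'}"
        using reach[OF that] by fastforce
      show "(\<lambda>U'. h (dial_value m U')) ` {U'. trans_set E U' \<and> subset E U U'} \<subseteq> T"
        using T_eq dial_value_le by blast
    qed
    have "true_at E U (map_modal \<sigma> q) \<longleftrightarrow> ksat T (h (dial_value m U)) q" if "trans_set E U" for q U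
      using that
    proof (induction q arbitrary: U)
      case (Atom n)
      then show ?case by (simp add: \<sigma>(2))
    next
      case (Box q)
      show ?case
        unfolding ksat.simps ball_image_Collect[OF T_image[OF Box.prems]] using Box.IH by simp
    next
      case (Dia q)
      show ?case
        unfolding ksat.simps bex_image_Collect[OF T_image[OF Dia.prems]] using Dia.IH by auto
    qed auto
    moreover have "h ?k = v" by (simp add: h_def)
    ultimately have "\<not> true_at E M (map_modal \<sigma> p)" using T(3) M by simp
    moreover have "true_at E M (map_modal \<sigma> p)" using ValD[OF p] \<sigma>(1) by blast
    ultimately show False by blast
  qed
qed

end

theorem theorem25:
  fixes E :: "'a \<Rightarrow> 'a \<Rightarrow> bool" and M :: 'a
  assumes "ZFC E"
    and "trans_set E M"
  shows "Val E M (lang E M) = S5 \<longleftrightarrow> (\<exists>\<delta>. Sigma_correct_cardinal E 2 \<delta> \<and> is_V E \<delta> M)"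
proof
  interpret ZFC E by (rule assms(1))
  assume "Val E M (lang E M) = S5"
  then have "Sigma_elementary E 2 M"
    using Sigma_elementary_if_S5[OF assms(2)] by blast
  then show "\<exists>\<delta>. Sigma_correct_cardinal E 2 \<delta> \<and> is_V E \<delta> M"
    by (rule Sigma_correct_if_elementary[OF assms(2)])
next
  interpret ZFC E by (rule assms(1))
  assume "\<exists>\<delta>. Sigma_correct_cardinal E 2 \<delta> \<and> is_V E \<delta> M"
  then obtain \<delta> v where "is_V E \<delta> v" "Sigma_elementary E 2 v" "is_V E \<delta> M"
    unfolding Sigma_correct_cardinal_def by blast
  moreover from this have "v = M" using V_unique by blast
  ultimately have "S5 \<subseteq> Val E M (lang E M)" using S5_if_elementary[OF assms(2)] by blast
  then show "Val E M (lang E M) = S5" using Val_subset_S5[OF assms(2)] by blast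
qed

end
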